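(* Let $A,C\subseteq\mathcal{G}_E$ be two non-empty internal sets, with $A$ functionally compact. Assume that $A$ and $C$ are strongly disjoint, and have sharply bounded representatives consisting of convex sets. Then there exist a continuous $\widetilde{\mathbb{R}}$-linear map $f=[f_\varepsilon]:\mathcal{G}_E\to\widetilde{\mathbb{R}}$ (with representatives), non-identically null, $\alpha\in\widetilde{\mathbb{R}}$, and $r\in\widetilde{\mathbb{R}}_{>0}$ such that $$\forall x\in A\ \forall y\in C:\ f(x)+r\le\alpha\le f(y)-r,$$ i.e. the closed hyperplane $\{f=\alpha\}$ strictly separates $A$ and $C$.
   Context: Let $I=(0,1]$ and fix a gauge, i.e. a net $\rho=(\rho_\varepsilon)\in I^I$ with $\rho_\varepsilon\to0$ as $\varepsilon\to0^+$. "For all $\varepsilon$ small" means for all $\varepsilon\in(0,\varepsilon_0]$ for some $\varepsilon_0\in I$. $E=(E_\varepsilon,\|\cdot\|_\varepsilon)_{\varepsilon\in I}$ is a family of real normed spaces; $\mathcal{M}_E=\{(u_\varepsilon)\in\prod_\varepsilon E_\varepsilon\mid\exists N\in\mathbb{N}:\|u_\varepsilon\|_\varepsilon=O(\rho_\varepsilon^{-N})\}$, $\mathcal{N}_E=\{(u_\varepsilon)\in\prod_\varepsilon E_\varepsilon\mid\forall N\in\mathbb{N}:\|u_\varepsilon\|_\varepsilon=O(\rho_\varepsilon^{N})\}$, $\mathcal{G}_E=\mathcal{M}_E/\mathcal{N}_E$, with classes $[u_\varepsilon]$. $\widetilde{\mathbb{R}}$ is the case $E_\varepsilon=\mathbb{R}$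 (nets $\mathcal{M}_{\mathbb{R}},\mathcal{N}_{\mathbb{R}}$); $\mathcal{G}_E$ is an $\widetilde{\mathbb{R}}$-module. Order: $x\le y$ iff for any representative $(x_\varepsilon)$ of $x$ there is a representative $(y_\varepsilon)$ of $y$ with $x_\varepsilon\le y_\varepsilon$ for all $\varepsilon$ small; $x>0$ iff $x\ge0$ and $x$ is invertible. $\|u\|=[\|u_\varepsilon\|_\varepsilon]$. Sharp topology: generated by the balls $B_r(u)=\{v:\|u-v\|<r\}$, $r\in\widetilde{\mathbb{R}}_{>0}$, on $\mathcal{G}_E$ and similarly on $\widetilde{\mathbb{R}}$ with $|\cdot|$. For $A_\varepsilon\subseteq E_\varepsilon$, $[A_\varepsilon]$ is the set of $u\in\mathcal{G}_E$ having a representative with $u_\varepsilon\in A_\varepsilon$ for all $\varepsilon$ small; a set $A=[A_\varepsilon]$ is called internal and $(A_\varepsilon)$ is a representative of $A$. $(A_\varepsilon)$ is sharply bounded if there is $N\in\mathbb{N}$ such that for all $\varepsilon$ small and all $u\in A_\varepsilon$, $\|u\|_\varepsilon\le\rho_\varepsilon^{-N}$. An internal set is functionally compact if it has a sharply bounded representative made of compact subsets $A_\varepsilon\subseteq E_\varepsilon$. $L\subseteq_0 I$ means $L\subseteq I$ and $0\in\overline{L}$; $\mathcal{G}_E|_L$ is the same quotient with index set $L$ instead of $I$, $u|_L$ is the restriction of $u$, $A|_L=\{u|_L: u\in A\}$. $A,C$ are strongly disjoint if $A|_L\cap C|_L=\emptyset$ for all $L\subseteq_0 I$. $f=[f_\varepsilon]$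 has representatives if $f_\varepsilon:E_\varepsilon\to\mathbb{R}$ are linear, map moderate nets to moderate nets and negligible nets to negligible nets, and $f([u_\varepsilon])=[f_\varepsilon(u_\varepsilon)]$. $f$ is non-identically null if $|f(x)|>0$ for some $x$. A hyperplane is a set $\{f=\alpha\}=\{u:f(u)=\alpha\}$ with $f$ linear non-identically null. *)

theory Defs
  imports "HOL-Analysis.Analysis" "HOL-Library.Landau_Symbols"
begin

definition idx :: "real set" where
  "idx = {0<..1}"

text \<open>``For all \<open>\<epsilon> \<in> L\<close> small'' is \<open>eventually\<close> with respect to this filter,
  and \<open>O[small L]\<close> is the corresponding Landau symbol.\<close>

abbreviation small :: "real set \<Rightarrow> real filter" where
  "small L \<equiv> at 0 within L"

definition gauge_net :: "(real \<Rightarrow> real) \<Rightarrow> bool" where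
  "gauge_net \<rho> \<longleftrightarrow> (\<forall>\<epsilon>\<in>idx. \<rho> \<epsilon> \<in> idx) \<and> (\<rho> \<longlongrightarrow> 0) (small idx)"


subsection \<open>Families of normed spaces\<close>

text \<open>The spaces of a family are linear subspaces of one ambient real vector space, each with
  its own norm. This loses no generality: an arbitrary family of real normed spaces embeds in
  this way into the direct sum of its underlying vector spaces.
  No norm and no topology on the ambient space is involved.\<close>

record 'a normed_family =
  space_at :: "real \<Rightarrow> 'a set"
  norm_at :: "real \<Rightarrow> 'a \<Rightarrow> real"

definition norm_on :: "'a::real_vector set \<Rightarrow> ('a \<Rightarrow> real) \<Rightarrow> bool" where
  "norm_on V n \<longleftrightarrow>
     (\<forall>x\<in>V. 0 \<le> n x \<and> (n x = 0 \<longleftrightarrow> x = 0)) \<and>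
     (\<forall>x\<in>V. \<forall>y\<in>V. n (x + y) \<le> n x + n y) \<and>
     (\<forall>x\<in>V. \<forall>c. n (c *\<^sub>R x) = \<bar>c\<bar> * n x)"

definition normed_spaces :: "'a::real_vector normed_family \<Rightarrow> bool" where
  "normed_spaces E \<longleftrightarrow>
     (\<forall>\<epsilon>\<in>idx. subspace (space_at E \<epsilon>) \<and> norm_on (space_at E \<epsilon>) (norm_at E \<epsilon>))"

definition real_line :: "real normed_family" where
  "real_line = \<lparr>space_at = (\<lambda>_. UNIV), norm_at = (\<lambda>_ x. \<bar>x\<bar>)\<rparr>"

text \<open>The cutoff is needed because the locale of metric spaces requires nonnegativity and symmetry
  of the distance also off the carrier, where \<open>norm_at E \<epsilon>\<close> is unconstrained.\<close>

definition dist_at :: "'a::real_vector normed_family \<Rightarrow> real \<Rightarrow> 'a \<Rightarrow> 'a \<Rightarrow> real" where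
  "dist_at E \<epsilon> x y =
     (if x \<in> space_at E \<epsilon> \<and> y \<in> space_at E \<epsilon> then norm_at E \<epsilon> (x - y) else 0)"

lemma Metric_space_dist_at:
  assumes "normed_spaces E" and "\<epsilon> \<in> idx"
  shows "Metric_space (space_at E \<epsilon>) (dist_at E \<epsilon>)"
proof -
  have V: "subspace (space_at E \<epsilon>)" and n: "norm_on (space_at E \<epsilon>) (norm_at E \<epsilon>)"
    using assms by (auto simp: normed_spaces_def)
  have nonneg: "0 \<le> norm_at E \<epsilon> x" and zero: "norm_at E \<epsilon> x = 0 \<longleftrightarrow> x = 0"
    and scale: "norm_at E \<epsilon> (c *\<^sub>R x) = \<bar>c\<bar> * norm_at E \<epsilon> x"
    if "x \<in> space_at E \<epsilon>" for x c
    using n[unfolded norm_on_def] that by blast+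
  have add: "norm_at E \<epsilon> (x + y) \<le> norm_at E \<epsilon> x + norm_at E \<epsilon> y"
    if "x \<in> space_at E \<epsilon>" "y \<in> space_at E \<epsilon>" for x y
    using n[unfolded norm_on_def] that by blast
  have swap: "norm_at E \<epsilon> (x - y) = norm_at E \<epsilon> (y - x)"
    if "x \<in> space_at E \<epsilon>" "y \<in> space_at E \<epsilon>" for x y
    using scale[OF subspace_diff[OF V that(2) that(1)], of "-1"] by simp
  have triangle: "norm_at E \<epsilon> (x - z) \<le> norm_at E \<epsilon> (x - y) + norm_at E \<epsilon> (y - z)"
    if "x \<in> space_at E \<epsilon>" "y \<in> space_at E \<epsilon>" "z \<in> space_at E \<epsilon>" for x y z
    using add[OF subspace_diff[OF V that(1) that(2)] subspace_diff[OF V that(2) that(3)]] by simp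
  have pos: "0 \<le> norm_at E \<epsilon> (x - y)" "norm_at E \<epsilon> (x - y) = 0 \<longleftrightarrow> x = y"
    if "x \<in> space_at E \<epsilon>" "y \<in> space_at E \<epsilon>" for x y
    using nonneg[OF subspace_diff[OF V that]] zero[OF subspace_diff[OF V that]] by simp_all
  show ?thesis
  proof
    show "0 \<le> dist_at E \<epsilon> x y" for x y
      by (simp add: dist_at_def pos(1))
    show "dist_at E \<epsilon> x y = dist_at E \<epsilon> y x" for x y
      using swap[of x y] by (simp add: dist_at_def)
    show "dist_at E \<epsilon> x y = 0 \<longleftrightarrow> x = y" if "x \<in> space_at E \<epsilon>" "y \<in> space_at E \<epsilon>" for x y
      using that by (simp add: dist_at_def pos(2))
    show "dist_at E \<epsilon> x z \<le> dist_at E \<epsilon> x y + dist_at E \<epsilon> y z"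
      if "x \<in> space_at E \<epsilon>" "y \<in> space_at E \<epsilon>" "z \<in> space_at E \<epsilon>" for x y z
      using that by (simp add: dist_at_def triangle)
  qed
qed

definition topology_at :: "'a::real_vector normed_family \<Rightarrow> real \<Rightarrow> 'a topology" where
  "topology_at E \<epsilon> = Metric_space.mtopology (space_at E \<epsilon>) (dist_at E \<epsilon>)"


subsection \<open>Moderate nets modulo negligible nets\<close>

text \<open>Everything is relative to an index set \<open>L\<close>, which is \<open>idx\<close> or a subset accumulating
  at \<open>0\<close>. Nets are extensional functions on \<open>L\<close>, and elements of the quotient are equivalence
  classes of nets, so \<open>v \<in> u\<close> says that \<open>v\<close> is a representative of \<open>u\<close>.\<close>

definition moderate ::
  "(real \<Rightarrow> real) \<Rightarrow> 'a::real_vector normed_family \<Rightarrow> real set \<Rightarrow> (real \<Rightarrow> 'a) set" where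
  "moderate \<rho> E L =
     {u \<in> Pi\<^sub>E L (space_at E).
        \<exists>N::nat. (\<lambda>\<epsilon>. norm_at E \<epsilon> (u \<epsilon>)) \<in> O[small L](\<lambda>\<epsilon>. inverse (\<rho> \<epsilon>) ^ N)}"

definition negligible_nets ::
  "(real \<Rightarrow> real) \<Rightarrow> 'a::real_vector normed_family \<Rightarrow> real set \<Rightarrow> (real \<Rightarrow> 'a) set" where
  "negligible_nets \<rho> E L =
     {u \<in> Pi\<^sub>E L (space_at E).
        \<forall>N::nat. (\<lambda>\<epsilon>. norm_at E \<epsilon> (u \<epsilon>)) \<in> O[small L](\<lambda>\<epsilon>. \<rho> \<epsilon> ^ N)}"

definition gen_rel ::
  "(real \<Rightarrow> real) \<Rightarrow> 'a::real_vector normed_family \<Rightarrow> real set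
     \<Rightarrow> ((real \<Rightarrow> 'a) \<times> (real \<Rightarrow> 'a)) set" where
  "gen_rel \<rho> E L =
     {(u, v). u \<in> moderate \<rho> E L \<and> v \<in> moderate \<rho> E L \<and>
              (\<lambda>\<epsilon>\<in>L. u \<epsilon> - v \<epsilon>) \<in> negligible_nets \<rho> E L}"

definition gen_space ::
  "(real \<Rightarrow> real) \<Rightarrow> 'a::real_vector normed_family \<Rightarrow> real set \<Rightarrow> (real \<Rightarrow> 'a) set set" where
  "gen_space \<rho> E L = moderate \<rho> E L // gen_rel \<rho> E L"

definition gen_class ::
  "(real \<Rightarrow> real) \<Rightarrow> 'a::real_vector normed_family \<Rightarrow> real set \<Rightarrow> (real \<Rightarrow> 'a) \<Rightarrow> (real \<Rightarrow> 'a) set" where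
  "gen_class \<rho> E L u = gen_rel \<rho> E L `` {u}"

abbreviation gen_reals :: "(real \<Rightarrow> real) \<Rightarrow> (real \<Rightarrow> real) set set" where
  "gen_reals \<rho> \<equiv> gen_space \<rho> real_line idx"


subsection \<open>Module structure, order and norm\<close>

text \<open>Each union below ranges over representatives and runs over copies of a single class,
  the usual way to lift an operation to a quotient.\<close>

definition gen_add ::
  "(real \<Rightarrow> real) \<Rightarrow> 'a::real_vector normed_family
     \<Rightarrow> (real \<Rightarrow> 'a) set \<Rightarrow> (real \<Rightarrow> 'a) set \<Rightarrow> (real \<Rightarrow> 'a) set" where
  "gen_add \<rho> E x y = (\<Union>u\<in>x. \<Union>v\<in>y. gen_class \<rho> E idx (\<lambda>\<epsilon>\<in>idx. u \<epsilon> + v \<epsilon>))"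

definition gen_diff ::
  "(real \<Rightarrow> real) \<Rightarrow> 'a::real_vector normed_family
     \<Rightarrow> (real \<Rightarrow> 'a) set \<Rightarrow> (real \<Rightarrow> 'a) set \<Rightarrow> (real \<Rightarrow> 'a) set" where
  "gen_diff \<rho> E x y = (\<Union>u\<in>x. \<Union>v\<in>y. gen_class \<rho> E idx (\<lambda>\<epsilon>\<in>idx. u \<epsilon> - v \<epsilon>))"

text \<open>For \<open>E = real_line\<close> this is the multiplication of the ring of generalized reals.\<close>

definition gen_scale ::
  "(real \<Rightarrow> real) \<Rightarrow> 'a::real_vector normed_family
     \<Rightarrow> (real \<Rightarrow> real) set \<Rightarrow> (real \<Rightarrow> 'a) set \<Rightarrow> (real \<Rightarrow> 'a) set" where
  "gen_scale \<rho> E c x = (\<Union>a\<in>c. \<Union>u\<in>x. gen_class \<rho> E idx (\<lambda>\<epsilon>\<in>idx. a \<epsilon> *\<^sub>R u \<epsilon>))"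

definition gen_norm ::
  "(real \<Rightarrow> real) \<Rightarrow> 'a::real_vector normed_family \<Rightarrow> (real \<Rightarrow> 'a) set \<Rightarrow> (real \<Rightarrow> real) set" where
  "gen_norm \<rho> E x = (\<Union>u\<in>x. gen_class \<rho> real_line idx (\<lambda>\<epsilon>\<in>idx. norm_at E \<epsilon> (u \<epsilon>)))"

definition gen_const :: "(real \<Rightarrow> real) \<Rightarrow> real \<Rightarrow> (real \<Rightarrow> real) set" where
  "gen_const \<rho> c = gen_class \<rho> real_line idx (\<lambda>\<epsilon>\<in>idx. c)"

definition gen_le :: "(real \<Rightarrow> real) set \<Rightarrow> (real \<Rightarrow> real) set \<Rightarrow> bool" where
  "gen_le x y \<longleftrightarrow> (\<forall>u\<in>x. \<exists>v\<in>y. \<forall>\<^sub>F \<epsilon> in small idx. u \<epsilon> \<le> v \<epsilon>)"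

definition gen_invertible :: "(real \<Rightarrow> real) \<Rightarrow> (real \<Rightarrow> real) set \<Rightarrow> bool" where
  "gen_invertible \<rho> x \<longleftrightarrow> (\<exists>y\<in>gen_reals \<rho>. gen_scale \<rho> real_line x y = gen_const \<rho> 1)"

definition gen_pos :: "(real \<Rightarrow> real) \<Rightarrow> (real \<Rightarrow> real) set \<Rightarrow> bool" where
  "gen_pos \<rho> x \<longleftrightarrow> gen_le (gen_const \<rho> 0) x \<and> gen_invertible \<rho> x"

definition gen_less ::
  "(real \<Rightarrow> real) \<Rightarrow> (real \<Rightarrow> real) set \<Rightarrow> (real \<Rightarrow> real) set \<Rightarrow> bool" where
  "gen_less \<rho> x y \<longleftrightarrow> gen_pos \<rho> (gen_diff \<rho> real_line y x)"


subsection \<open>Sharp topology\<close>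

definition sharp_ball ::
  "(real \<Rightarrow> real) \<Rightarrow> 'a::real_vector normed_family
     \<Rightarrow> (real \<Rightarrow> 'a) set \<Rightarrow> (real \<Rightarrow> real) set \<Rightarrow> (real \<Rightarrow> 'a) set set" where
  "sharp_ball \<rho> E u r =
     {v \<in> gen_space \<rho> E idx. gen_less \<rho> (gen_norm \<rho> E (gen_diff \<rho> E u v)) r}"

definition sharp_topology ::
  "(real \<Rightarrow> real) \<Rightarrow> 'a::real_vector normed_family \<Rightarrow> (real \<Rightarrow> 'a) set topology" where
  "sharp_topology \<rho> E =
     topology_generated_by
       {sharp_ball \<rho> E u r | u r. u \<in> gen_space \<rho> E idx \<and> r \<in> gen_reals \<rho> \<and> gen_pos \<rho> r}"


subsection \<open>Internal sets\<close>

definition internal_set ::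
  "(real \<Rightarrow> real) \<Rightarrow> 'a::real_vector normed_family \<Rightarrow> (real \<Rightarrow> 'a set) \<Rightarrow> (real \<Rightarrow> 'a) set set" where
  "internal_set \<rho> E S =
     {u \<in> gen_space \<rho> E idx. \<exists>v\<in>u. \<forall>\<^sub>F \<epsilon> in small idx. v \<epsilon> \<in> S \<epsilon>}"

definition set_representative ::
  "(real \<Rightarrow> real) \<Rightarrow> 'a::real_vector normed_family
     \<Rightarrow> (real \<Rightarrow> 'a) set set \<Rightarrow> (real \<Rightarrow> 'a set) \<Rightarrow> bool" where
  "set_representative \<rho> E A S \<longleftrightarrow>
     (\<forall>\<epsilon>\<in>idx. S \<epsilon> \<subseteq> space_at E \<epsilon>) \<and> A = internal_set \<rho> E S"

definition internal ::
  "(real \<Rightarrow> real) \<Rightarrow> 'a::real_vector normed_family \<Rightarrow> (real \<Rightarrow> 'a) set set \<Rightarrow> bool" where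
  "internal \<rho> E A \<longleftrightarrow> (\<exists>S. set_representative \<rho> E A S)"

definition sharply_bounded ::
  "(real \<Rightarrow> real) \<Rightarrow> 'a::real_vector normed_family \<Rightarrow> (real \<Rightarrow> 'a set) \<Rightarrow> bool" where
  "sharply_bounded \<rho> E S \<longleftrightarrow>
     (\<exists>N::nat. \<forall>\<^sub>F \<epsilon> in small idx. \<forall>u\<in>S \<epsilon>. norm_at E \<epsilon> u \<le> inverse (\<rho> \<epsilon>) ^ N)"

definition functionally_compact ::
  "(real \<Rightarrow> real) \<Rightarrow> 'a::real_vector normed_family \<Rightarrow> (real \<Rightarrow> 'a) set set \<Rightarrow> bool" where
  "functionally_compact \<rho> E A \<longleftrightarrow>
     (\<exists>S. set_representative \<rho> E A S \<and> sharply_bounded \<rho> E S \<and>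
          (\<forall>\<epsilon>\<in>idx. compactin (topology_at E \<epsilon>) (S \<epsilon>)))"

definition has_bounded_convex_representative ::
  "(real \<Rightarrow> real) \<Rightarrow> 'a::real_vector normed_family \<Rightarrow> (real \<Rightarrow> 'a) set set \<Rightarrow> bool" where
  "has_bounded_convex_representative \<rho> E A \<longleftrightarrow>
     (\<exists>S. set_representative \<rho> E A S \<and> sharply_bounded \<rho> E S \<and> (\<forall>\<epsilon>\<in>idx. convex (S \<epsilon>)))"

definition gen_restrict ::
  "(real \<Rightarrow> real) \<Rightarrow> 'a::real_vector normed_family \<Rightarrow> real set
     \<Rightarrow> (real \<Rightarrow> 'a) set \<Rightarrow> (real \<Rightarrow> 'a) set" where
  "gen_restrict \<rho> E L u = (\<Union>v\<in>u. gen_class \<rho> E L (restrict v L))"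

definition strongly_disjoint ::
  "(real \<Rightarrow> real) \<Rightarrow> 'a::real_vector normed_family
     \<Rightarrow> (real \<Rightarrow> 'a) set set \<Rightarrow> (real \<Rightarrow> 'a) set set \<Rightarrow> bool" where
  "strongly_disjoint \<rho> E A C \<longleftrightarrow>
     (\<forall>L. L \<subseteq> idx \<and> 0 \<in> closure L \<longrightarrow>
        gen_restrict \<rho> E L ` A \<inter> gen_restrict \<rho> E L ` C = {})"


subsection \<open>Linear maps into the generalized reals\<close>

definition gen_linear ::
  "(real \<Rightarrow> real) \<Rightarrow> 'a::real_vector normed_family
     \<Rightarrow> ((real \<Rightarrow> 'a) set \<Rightarrow> (real \<Rightarrow> real) set) \<Rightarrow> bool" where
  "gen_linear \<rho> E f \<longleftrightarrow>
     f \<in> gen_space \<rho> E idx \<rightarrow> gen_reals \<rho> \<and>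
     (\<forall>x\<in>gen_space \<rho> E idx. \<forall>y\<in>gen_space \<rho> E idx.
        f (gen_add \<rho> E x y) = gen_add \<rho> real_line (f x) (f y)) \<and>
     (\<forall>c\<in>gen_reals \<rho>. \<forall>x\<in>gen_space \<rho> E idx.
        f (gen_scale \<rho> E c x) = gen_scale \<rho> real_line c (f x))"

definition map_representative ::
  "(real \<Rightarrow> real) \<Rightarrow> 'a::real_vector normed_family
     \<Rightarrow> ((real \<Rightarrow> 'a) set \<Rightarrow> (real \<Rightarrow> real) set) \<Rightarrow> (real \<Rightarrow> 'a \<Rightarrow> real) \<Rightarrow> bool" where
  "map_representative \<rho> E f F \<longleftrightarrow>
     (\<forall>\<epsilon>\<in>idx. \<forall>x\<in>space_at E \<epsilon>.
        (\<forall>y\<in>space_at E \<epsilon>. F \<epsilon> (x + y) = F \<epsilon> x + F \<epsilon> y) \<and>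
        (\<forall>c. F \<epsilon> (c *\<^sub>R x) = c * F \<epsilon> x)) \<and>
     (\<forall>u\<in>moderate \<rho> E idx. (\<lambda>\<epsilon>\<in>idx. F \<epsilon> (u \<epsilon>)) \<in> moderate \<rho> real_line idx) \<and>
     (\<forall>u\<in>negligible_nets \<rho> E idx. (\<lambda>\<epsilon>\<in>idx. F \<epsilon> (u \<epsilon>)) \<in> negligible_nets \<rho> real_line idx) \<and>
     (\<forall>u\<in>moderate \<rho> E idx.
        f (gen_class \<rho> E idx u) = gen_class \<rho> real_line idx (\<lambda>\<epsilon>\<in>idx. F \<epsilon> (u \<epsilon>)))"

definition non_identically_null ::
  "(real \<Rightarrow> real) \<Rightarrow> 'a::real_vector normed_family
     \<Rightarrow> ((real \<Rightarrow> 'a) set \<Rightarrow> (real \<Rightarrow> real) set) \<Rightarrow> bool" where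
  "non_identically_null \<rho> E f \<longleftrightarrow>
     (\<exists>x\<in>gen_space \<rho> E idx. gen_pos \<rho> (gen_norm \<rho> real_line (f x)))"

definition level_set ::
  "(real \<Rightarrow> real) \<Rightarrow> 'a::real_vector normed_family
     \<Rightarrow> ((real \<Rightarrow> 'a) set \<Rightarrow> (real \<Rightarrow> real) set) \<Rightarrow> (real \<Rightarrow> real) set \<Rightarrow> (real \<Rightarrow> 'a) set set" where
  "level_set \<rho> E f \<alpha> = {u \<in> gen_space \<rho> E idx. f u = \<alpha>}"

end

theory Submission
  imports Defs
begin

text \<open>
  If the convex representatives \<open>S \<epsilon>\<close>, \<open>T \<epsilon>\<close> of the two sets came closer than \<open>\<rho> \<epsilon> ^ N\<close> along some
  indices tending to \<open>0\<close>, for every \<open>N\<close>, then a diagonal choice of indices \<open>e k\<close> would produce an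
  \<open>L = range e\<close> along which the two internal sets meet. So strong disjointness yields a gap \<open>\<rho> \<epsilon> ^ N\<close> between
  \<open>S \<epsilon>\<close> and \<open>T \<epsilon>\<close> for small \<open>\<epsilon>\<close>, and for each such \<open>\<epsilon>\<close> the Hahn-Banach theorem gives a functional of
  norm at most \<open>1\<close> that separates them by \<open>\<rho> \<epsilon> ^ N\<close>. Because their norms are at most \<open>1\<close>, these
  functionals define a continuous linear map on the quotient; since the gap is a power of the gauge,
  it is invertible, and the separation is strict.
\<close>

subsection \<open>Separation by sublinear functionals\<close>

text \<open>The norm of each fibre is a mere function on a subspace, so separation is carried out
  with sublinear functionals on the ambient space. Zorn's lemma is applied to total sublinear
  functionals ordered downwards, where a minimal element is linear; no partially defined functional
  is ever extended.

  Strong disjointness, rather than disjointness, is what forces the gap: the failure of every gap is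
  witnessed only along some sequence of indices, and the resulting common point exists only after
  restriction to that sequence. Points chosen freely there still extend to moderate nets because the
  representatives are sharply bounded; the same bound makes the separating level, built from a
  supremum over \<open>S \<epsilon>\<close>, moderate.

  The passage to classes rests on one remark: since \<rho> tends to 0, a constant factor is
  outweighed by one further power of \<rho>. Hence equality of classes, positivity and membership in
  sharp balls all become comparisons with powers of \<rho>, with constant one, for all small
  \<epsilon>.\<close>

definition sublinear :: "('a::real_vector \<Rightarrow> real) \<Rightarrow> bool" where
  "sublinear p \<longleftrightarrow> (\<forall>x y. p (x + y) \<le> p x + p y) \<and> (\<forall>c\<ge>0. \<forall>x. p (c *\<^sub>R x) = c * p x)"

lemma sublinear_add: "sublinear p \<Longrightarrow> p (x + y) \<le> p x + p y"
  by (simp add: sublinear_def)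

lemma sublinear_scale: "sublinear p \<Longrightarrow> 0 \<le> c \<Longrightarrow> p (c *\<^sub>R x) = c * p x"
  by (simp add: sublinear_def)

lemma sublinear_zero: "sublinear p \<Longrightarrow> p 0 = 0"
  using sublinear_scale[of p 0 0] by simp

lemma sublinear_minus: "sublinear p \<Longrightarrow> - p (- x) \<le> p x"
  using sublinear_add[of p x "- x"] sublinear_zero[of p] by simp

text \<open>Scaling by \<open>inverse c\<close> undoes scaling by \<open>c\<close>, so the one-sided
  estimate for positive factors already forces equality.\<close>

lemma sublinearI:
  assumes "\<And>x y. p (x + y) \<le> p x + p y" and "p 0 = 0"
    and scale: "\<And>c x. 0 < c \<Longrightarrow> p (c *\<^sub>R x) \<le> c * p x"
  shows "sublinear p"
proof -
  have "p (c *\<^sub>R x) = c * p x" if "0 \<le> c" for c x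
  proof (cases "c = 0")
    case False
    with that have c: "0 < c" by simp
    have "p x \<le> inverse c * p (c *\<^sub>R x)"
      using scale[of "inverse c" "c *\<^sub>R x"] c by simp
    then have "c * p x \<le> p (c *\<^sub>R x)"
      using c by (simp add: field_simps)
    with scale[OF c, of x] show ?thesis by simp
  qed (simp add: assms)
  then show ?thesis
    using assms by (simp add: sublinear_def)
qed

text \<open>
  This lemma serves twice: with \<open>K = {y}\<close> and \<open>d = p y\<close> it forces a minimal sublinear functional to
  be linear, and with a general \<open>K\<close> it turns the existence of a linear functional below \<open>p\<close> into
  separation of \<open>K\<close> from \<open>0\<close>.
\<close>

lemma sublinear_reduce:
  fixes p :: "'a::real_vector \<Rightarrow> real"
  assumes p: "sublinear p" and K: "convex K" "K \<noteq> {}" and d: "\<And>k. k \<in> K \<Longrightarrow> d \<le> p k"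
  obtains q where "sublinear q" "\<And>x. q x \<le> p x" "\<And>k. k \<in> K \<Longrightarrow> q (- k) \<le> - d"
proof -
  \<comment> \<open>Any sublinear \<open>r \<le> p\<close> with \<open>r (- k) \<le> - d\<close> on
    \<open>K\<close> satisfies \<open>r x \<le> r (x + t *\<^sub>R k) + t * r (- k) \<le> p (x + t
    *\<^sub>R k) - t * d\<close>. The infimum of these forced upper bounds is therefore the largest
    possible candidate.\<close>
  define V where "V x = {p (x + t *\<^sub>R k) - t * d | t k. 0 \<le> t \<and> k \<in> K}" for x
  define q where "q x = Inf (V x)" for x
  obtain k0 where k0: "k0 \<in> K" using K by blast
  have nonempty: "V x \<noteq> {}" for x
    unfolding V_def using k0 order_refl[of "0::real"] by blast
  \<comment> \<open>Here \<open>d \<le> p k\<close> enters: it gives a lower bound free of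
    \<open>t\<close> and \<open>k\<close>, so the infimum is finite.\<close>
  have below: "- p (- x) \<le> p (x + t *\<^sub>R k) - t * d" if "0 \<le> t" "k \<in> K" for x t k
  proof -
    have "t * d \<le> p (t *\<^sub>R k)"
      using d[OF that(2)] that(1) by (simp add: sublinear_scale[OF p] mult_left_mono)
    also have "\<dots> \<le> p (x + t *\<^sub>R k) + p (- x)"
      using sublinear_add[OF p, of "x + t *\<^sub>R k" "- x"] by simp
    finally show ?thesis by simp
  qed
  have bdd: "bdd_below (V x)" for x
    unfolding V_def using below by (intro bdd_belowI[of _ "- p (- x)"]) auto
  have le: "q x \<le> p (x + t *\<^sub>R k) - t * d" if "0 \<le> t" "k \<in> K" for x t k
    unfolding q_def by (rule cInf_lower[OF _ bdd]) (use that in \<open>auto simp: V_def\<close>)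
  have ge: "m \<le> q x" if "\<And>t k. 0 \<le> t \<Longrightarrow> k \<in> K \<Longrightarrow> m \<le> p (x + t *\<^sub>R k) - t * d" for m x
    unfolding q_def by (rule cInf_greatest[OF nonempty]) (use that in \<open>auto simp: V_def\<close>)
  have add: "q (x + y) \<le> q x + q y" for x y
  proof -
    \<comment> \<open>The multiples \<open>t *\<^sub>R k\<close> and \<open>s *\<^sub>R l\<close>
      have to be merged into a single multiple of an element of \<open>K\<close>, which is where
      convexity enters. The subtracted form lets \<open>ge\<close> take the infimum over one pair
      while the other is fixed.\<close>
    have key: "q (x + y) - (p (x + t *\<^sub>R k) - t * d) \<le> p (y + s *\<^sub>R l) - s * d"
      if ts: "0 \<le> t" "k \<in> K" "0 \<le> s" "l \<in> K" for t k s l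
    proof -
      obtain m where m: "m \<in> K" "t *\<^sub>R k + s *\<^sub>R l = (t + s) *\<^sub>R m"
      proof (cases "t + s = 0")
        case True
        with ts have "t = 0" "s = 0" by auto
        with ts(2) show ?thesis by (intro that[of k]) auto
      next
        case False
        show ?thesis
        proof (rule that)
          show "(t / (t + s)) *\<^sub>R k + (s / (t + s)) *\<^sub>R l \<in> K"
            using ts False by (intro convexD[OF K(1)]) (auto simp: add_divide_distrib[symmetric])
          show "t *\<^sub>R k + s *\<^sub>R l = (t + s) *\<^sub>R ((t / (t + s)) *\<^sub>R k + (s / (t + s)) *\<^sub>R l)"
            using False by (simp add: scaleR_add_right)
        qed
      qed
      have "q (x + y) \<le> p ((x + y) + (t + s) *\<^sub>R m) - (t + s) * d"
        using le[of "t + s" m "x + y"] m ts by simp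
      also have "(x + y) + (t + s) *\<^sub>R m = (x + t *\<^sub>R k) + (y + s *\<^sub>R l)"
        unfolding m(2)[symmetric] by (simp add: algebra_simps)
      also have "p \<dots> \<le> p (x + t *\<^sub>R k) + p (y + s *\<^sub>R l)"
        by (rule sublinear_add[OF p])
      finally show ?thesis by (simp add: algebra_simps)
    qed
    have "q (x + y) - q y \<le> p (x + t *\<^sub>R k) - t * d" if "0 \<le> t" "k \<in> K" for t k
    proof -
      have "q (x + y) - (p (x + t *\<^sub>R k) - t * d) \<le> q y"
        by (rule ge) (rule key[OF that])
      then show ?thesis by linarith
    qed
    then have "q (x + y) - q y \<le> q x"
      by (rule ge)
    then show ?thesis by simp
  qed
  show ?thesis
  proof (rule that)
    show qp: "q x \<le> p x" for x
      using le[of 0 k0 x] k0 by simp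
    show "q (- k) \<le> - d" if "k \<in> K" for k
      using le[of 1 k "- k"] that by (simp add: sublinear_zero[OF p])
    show "sublinear q"
    proof (rule sublinearI[OF add])
      show "q 0 = 0"
        using qp[of 0] ge[of 0 0] below[of _ _ 0] by (auto simp: sublinear_zero[OF p] intro!: antisym)
      show "q (c *\<^sub>R x) \<le> c * q x" if "0 < c" for c x
      proof -
        have "q (c *\<^sub>R x) / c \<le> q x"
        proof (rule ge)
          fix t :: real and k assume "0 \<le> t" "k \<in> K"
          then have "q (c *\<^sub>R x) \<le> p (c *\<^sub>R (x + t *\<^sub>R k)) - c * t * d"
            using le[of "c * t" k "c *\<^sub>R x"] that by (simp add: scaleR_add_right)
          also have "\<dots> = c * (p (x + t *\<^sub>R k) - t * d)"
            using that by (simp add: sublinear_scale[OF p] right_diff_distrib)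
          finally show "q (c *\<^sub>R x) / c \<le> p (x + t *\<^sub>R k) - t * d"
            using that by (simp add: field_simps)
        qed
        then show ?thesis using that by (simp add: field_simps)
      qed
    qed
  qed
qed

text \<open>A pointwise infimum of sublinear functionals need not be subadditive. In a chain,
  however, the functionals used at \<open>x\<close> and at \<open>y\<close> can both be replaced by
  the smaller of the two. The common majorant \<open>p\<close> keeps the infimum finite, since
  \<open>- p (- x) \<le> - q (- x) \<le> q x\<close>.\<close>

lemma sublinear_chain_Inf:
  assumes "C \<noteq> {}" and sub: "\<And>q. q \<in> C \<Longrightarrow> sublinear q" and le: "\<And>q x. q \<in> C \<Longrightarrow> q x \<le> p x"
    and chain: "\<And>q r. q \<in> C \<Longrightarrow> r \<in> C \<Longrightarrow> q \<le> r \<or> r \<le> q"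
  shows "sublinear (\<lambda>x. INF q\<in>C. q x)" and "\<And>q x. q \<in> C \<Longrightarrow> (INF q\<in>C. q x) \<le> q x"
proof -
  let ?q = "\<lambda>x. INF q\<in>C. q x"
  have bdd: "bdd_below ((\<lambda>q. q x) ` C)" for x
  proof (rule bdd_belowI2)
    show "- p (- x) \<le> q x" if "q \<in> C" for q
      using sublinear_minus[OF sub[OF that], of x] le[OF that, of "- x"] by simp
  qed
  show lower: "?q x \<le> q x" if "q \<in> C" for q x
    by (rule cINF_lower[OF bdd that])
  have ge: "m \<le> ?q x" if "\<And>q. q \<in> C \<Longrightarrow> m \<le> q x" for m x
    by (rule cINF_greatest[OF assms(1)]) (rule that)
  show "sublinear ?q"
  proof (rule sublinearI)
    show "?q (x + y) \<le> ?q x + ?q y" for x y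
    proof -
      have key: "?q (x + y) - q x \<le> r y" if qr: "q \<in> C" "r \<in> C" for q r
      proof -
        obtain s where s: "s \<in> C" "s \<le> q" "s \<le> r"
          using chain[OF qr] qr by blast
        have "?q (x + y) \<le> s (x + y)" by (rule lower[OF s(1)])
        also have "\<dots> \<le> s x + s y" by (rule sublinear_add[OF sub[OF s(1)]])
        also have "\<dots> \<le> q x + r y" using s by (intro add_mono) (auto simp: le_fun_def)
        finally show ?thesis by linarith
      qed
      have "?q (x + y) - ?q y \<le> q x" if "q \<in> C" for q
      proof -
        have "?q (x + y) - q x \<le> ?q y"
          by (rule ge) (rule key[OF that])
        then show ?thesis by linarith
      qed
      then have "?q (x + y) - ?q y \<le> ?q x"
        by (rule ge)
      then show ?thesis by simp
    qed
    show "?q 0 = 0"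
      using assms(1) by (simp add: sublinear_zero[OF sub] cong: INF_cong_simp)
    show "?q (c *\<^sub>R x) \<le> c * ?q x" if "0 < c" for c x
    proof -
      have "?q (c *\<^sub>R x) / c \<le> ?q x"
        using lower[of _ "c *\<^sub>R x"] sublinear_scale[OF sub, of _ c x] that
        by (intro ge) (force simp: field_simps)
      then show ?thesis using that by (simp add: field_simps)
    qed
  qed
qed

text \<open>Minimality identifies the reduced functional with \<open>q\<close> itself, so
  \<open>q\<close> is odd; subadditivity applied to \<open>x\<close>, \<open>y\<close> and to
  \<open>x + y\<close>, \<open>- y\<close> then gives both halves of additivity.\<close>

lemma minimal_sublinear_linear:
  assumes q: "sublinear q" and minimal: "\<And>r. sublinear r \<Longrightarrow> r \<le> q \<Longrightarrow> r = q"
  shows "linear q"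
proof -
  have minus: "q (- y) = - q y" for y
  proof -
    obtain r where r: "sublinear r" "\<And>x. r x \<le> q x" "\<And>k. k \<in> {y} \<Longrightarrow> r (- k) \<le> - q y"
      by (rule sublinear_reduce[OF q, of "{y}" "q y"]) auto
    then have "r = q" by (intro minimal) (auto simp: le_fun_def)
    with r(3)[of y] sublinear_minus[OF q, of "y"] show ?thesis by simp
  qed
  show ?thesis
  proof (rule linearI)
    show "q (x + y) = q x + q y" for x y
      using sublinear_add[OF q, of x y] sublinear_add[OF q, of "x + y" "- y"] minus[of y] by simp
    show "q (c *\<^sub>R x) = c *\<^sub>R q x" for c x
      using sublinear_scale[OF q, of c x] sublinear_scale[OF q, of "- c" x] minus[of "c *\<^sub>R x"]
      by (cases "0 \<le> c") auto
  qed
qed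

lemma Hahn_Banach_sublinear:
  assumes p: "sublinear p"
  obtains f where "linear f" "\<And>x. f x \<le> p x"
proof -
  define X where "X = {q. sublinear q \<and> q \<le> p}"
  \<comment> \<open>The order is reversed, so that the maximal element supplied by Zorn's lemma is a
    minimal functional.\<close>
  define P where "P = (\<lambda>q r :: 'a \<Rightarrow> real. r \<le> q)"
  have "\<exists>m\<in>X. \<forall>a\<in>X. P m a \<longrightarrow> a = m"
  proof (rule predicate_Zorn)
    show "partial_order_on X (relation_of P X)"
      by (rule partial_order_on_relation_ofI) (auto simp: P_def)
    show "\<exists>u\<in>X. \<forall>a\<in>C. P a u" if "C \<in> Chains (relation_of P X)" for C
    proof (cases "C = {}")
      case True
      with p show ?thesis by (auto simp: X_def)
    next
      case False
      have C: "q \<in> X" if "q \<in> C" for q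
        using \<open>C \<in> _\<close> that by (auto simp: Chains_def relation_of_def)
      have chain: "q \<le> r \<or> r \<le> q" if "q \<in> C" "r \<in> C" for q r
        using \<open>C \<in> _\<close> that by (auto simp: Chains_def relation_of_def P_def)
      have sub: "sublinear q" and le: "q x \<le> p x" if "q \<in> C" for q x
        using C[OF that] by (auto simp: X_def le_fun_def)
      have inf: "sublinear (\<lambda>x. INF q\<in>C. q x)" "\<And>q x. q \<in> C \<Longrightarrow> (INF q\<in>C. q x) \<le> q x"
        using sublinear_chain_Inf[of C p] False sub le chain by blast+
      obtain q where "q \<in> C" using False by blast
      then have "(\<lambda>x. INF q\<in>C. q x) \<le> p"
        using inf(2)[of q] le[of q] by (auto simp: le_fun_def intro: order_trans)
      with inf show ?thesis
        by (intro bexI[of _ "\<lambda>x. INF q\<in>C. q x"]) (auto simp: X_def P_def le_fun_def)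
    qed
  qed
  then obtain f where f: "f \<in> X" "\<And>a. a \<in> X \<Longrightarrow> a \<le> f \<Longrightarrow> a = f"
    unfolding P_def by blast
  \<comment> \<open>Minimality within \<open>X\<close> is minimality among all sublinear
    functionals, because whatever lies below \<open>f\<close> also lies below
    \<open>p\<close>.\<close>
  have "linear f"
    by (rule minimal_sublinear_linear) (use f in \<open>auto simp: X_def intro: order_trans\<close>)
  then show ?thesis
    using f(1) by (intro that[of f]) (auto simp: X_def le_fun_def)
qed

text \<open>A linear \<open>f\<close> below the reduced functional inherits the upper bound
  \<open>- d\<close> at \<open>- k\<close>, and linearity turns this into the lower bound
  \<open>d\<close> at \<open>k\<close>.\<close>

lemma sublinear_separation:
  assumes "sublinear p" "convex K" "K \<noteq> {}" "\<And>k. k \<in> K \<Longrightarrow> d \<le> p k"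
  obtains f where "linear f" "\<And>x. f x \<le> p x" "\<And>k. k \<in> K \<Longrightarrow> d \<le> f k"
proof -
  obtain q where q: "sublinear q" "\<And>x. q x \<le> p x" "\<And>k. k \<in> K \<Longrightarrow> q (- k) \<le> - d"
    using sublinear_reduce[OF assms] by blast
  obtain f where f: "linear f" "\<And>x. f x \<le> q x"
    using Hahn_Banach_sublinear[OF q(1)] by blast
  show ?thesis
  proof (rule that[OF f(1)])
    show "f x \<le> p x" for x
      using f(2) q(2) order_trans by blast
    show "d \<le> f k" if "k \<in> K" for k
      using f(2)[of "- k"] q(3)[OF that] by (simp add: linear_neg[OF f(1)])
  qed
qed

text \<open>Separating \<open>S\<close> from \<open>T\<close> amounts to separating the convex
  difference set \<open>K = T - S\<close> from 0, on which the norm is at least \<open>d\<close> by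
  hypothesis. Domination by a seminorm, used at \<open>x\<close> and at \<open>- x\<close>, bounds
  the absolute value of the functional.\<close>

lemma norm_on_separation:
  fixes V :: "'a::real_vector set"
  assumes V: "subspace V" and n: "norm_on V n"
    and S: "convex S" "S \<noteq> {}" "S \<subseteq> V" and T: "convex T" "T \<noteq> {}" "T \<subseteq> V"
    and d: "\<And>a c. a \<in> S \<Longrightarrow> c \<in> T \<Longrightarrow> d \<le> n (c - a)"
  obtains f where "linear f" "\<And>x. x \<in> V \<Longrightarrow> \<bar>f x\<bar> \<le> n x"
    "\<And>a c. a \<in> S \<Longrightarrow> c \<in> T \<Longrightarrow> f a + d \<le> f c"
proof -
  \<comment> \<open>Composing with a projection onto \<open>V\<close> makes \<open>n\<close> a seminorm on the whole ambient space.\<close>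
  obtain \<pi> :: "'a \<Rightarrow> 'a" where \<pi>: "linear \<pi>" "\<And>x. \<pi> x \<in> V" "\<And>x. x \<in> V \<Longrightarrow> \<pi> x = x"
    using linear_exists_left_inverse_on[OF linear_id V] by auto
  have p: "sublinear (\<lambda>x. n (\<pi> x))"
    using n \<pi>(2) by (auto simp: sublinear_def norm_on_def linear_add[OF \<pi>(1)] linear_scale[OF \<pi>(1)])
  define K where "K = (\<Union>x\<in>T. \<Union>y\<in>S. {x - y})"
  have K: "convex K" "K \<noteq> {}"
    unfolding K_def using S T by (auto intro: convex_differences)
  have le: "d \<le> n (\<pi> k)" if "k \<in> K" for k
    using that d S T \<pi>(3) subspace_diff[OF V] unfolding K_def by (auto simp: subset_iff)
  obtain f where f: "linear f" "\<And>x. f x \<le> n (\<pi> x)" "\<And>k. k \<in> K \<Longrightarrow> d \<le> f k"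
    using sublinear_separation[OF p K le] by blast
  show ?thesis
  proof (rule that[OF f(1)])
    show "\<bar>f x\<bar> \<le> n x" if "x \<in> V" for x
    proof -
      have "n (- x) = n x"
        using n that unfolding norm_on_def by (metis abs_minus abs_one mult_1 scaleR_minus1_left)
      then show ?thesis
        using f(2)[of x] f(2)[of "- x"] that \<pi>(3) subspace_neg[OF V that]
        by (auto simp: linear_neg[OF f(1)])
    qed
    show "f a + d \<le> f c" if "a \<in> S" "c \<in> T" for a c
      proof -
      have "c - a \<in> K" using that unfolding K_def by blast
      then show ?thesis using f(3)[of "c - a"] by (simp add: linear_diff[OF f(1)])
    qed
  qed
qed

subsection \<open>Nets modulo negligible nets\<close>

lemma space_at_real_line [simp]: "space_at real_line \<epsilon> = UNIV"
  and norm_at_real_line [simp]: "norm_at real_line \<epsilon> x = \<bar>x\<bar>"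
  by (simp_all add: real_line_def)

lemma normed_spaces_real_line: "normed_spaces real_line"
  by (auto simp: normed_spaces_def norm_on_def abs_mult subspace_UNIV)

text \<open>The family is a parameter so that the same facts can be instantiated a second time with
  \<open>real_line\<close>, where they speak of the generalized reals.\<close>

locale generalized_space =
  fixes \<rho> :: "real \<Rightarrow> real" and E :: "'a::real_vector normed_family"
  assumes gauge: "gauge_net \<rho>" and normed: "normed_spaces E"
begin

lemma rho_pos: "\<epsilon> \<in> idx \<Longrightarrow> 0 < \<rho> \<epsilon>"
  and rho_le_1: "\<epsilon> \<in> idx \<Longrightarrow> \<rho> \<epsilon> \<le> 1"
  using gauge by (auto simp: gauge_net_def idx_def)

lemma inverse_rho_ge_1: "\<epsilon> \<in> idx \<Longrightarrow> 1 \<le> inverse (\<rho> \<epsilon>)"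
  by (simp add: one_le_inverse rho_pos rho_le_1)

lemma subspace_space_at: "\<epsilon> \<in> idx \<Longrightarrow> subspace (space_at E \<epsilon>)"
  using normed by (simp add: normed_spaces_def)

lemma norm_on_norm_at: "\<epsilon> \<in> idx \<Longrightarrow> norm_on (space_at E \<epsilon>) (norm_at E \<epsilon>)"
  using normed by (simp add: normed_spaces_def)

lemma norm_at_nonneg: "\<epsilon> \<in> idx \<Longrightarrow> x \<in> space_at E \<epsilon> \<Longrightarrow> 0 \<le> norm_at E \<epsilon> x"
  by (drule norm_on_norm_at) (simp add: norm_on_def)

lemma norm_at_zero: "\<epsilon> \<in> idx \<Longrightarrow> norm_at E \<epsilon> 0 = 0"
  using norm_on_norm_at[of \<epsilon>] subspace_0[OF subspace_space_at[of \<epsilon>]] by (simp add: norm_on_def)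

lemma norm_at_add: "\<epsilon> \<in> idx \<Longrightarrow> x \<in> space_at E \<epsilon> \<Longrightarrow> y \<in> space_at E \<epsilon> \<Longrightarrow>
    norm_at E \<epsilon> (x + y) \<le> norm_at E \<epsilon> x + norm_at E \<epsilon> y"
  by (drule norm_on_norm_at) (simp add: norm_on_def)

lemma norm_at_scale: "\<epsilon> \<in> idx \<Longrightarrow> x \<in> space_at E \<epsilon> \<Longrightarrow>
    norm_at E \<epsilon> (c *\<^sub>R x) = \<bar>c\<bar> * norm_at E \<epsilon> x"
  by (drule norm_on_norm_at) (simp add: norm_on_def)

lemma norm_at_minus: "\<epsilon> \<in> idx \<Longrightarrow> x \<in> space_at E \<epsilon> \<Longrightarrow> norm_at E \<epsilon> (- x) = norm_at E \<epsilon> x"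
  using norm_at_scale[of \<epsilon> x "- 1"] by simp

lemma norm_at_diff: "\<epsilon> \<in> idx \<Longrightarrow> x \<in> space_at E \<epsilon> \<Longrightarrow> y \<in> space_at E \<epsilon> \<Longrightarrow>
    norm_at E \<epsilon> (x - y) \<le> norm_at E \<epsilon> x + norm_at E \<epsilon> y"
  using norm_at_add[of \<epsilon> x "- y"] norm_at_minus[of \<epsilon> y] by (simp add: subspace_neg subspace_space_at)

lemma norm_at_triangle: "\<epsilon> \<in> idx \<Longrightarrow> x \<in> space_at E \<epsilon> \<Longrightarrow> y \<in> space_at E \<epsilon> \<Longrightarrow>
    z \<in> space_at E \<epsilon> \<Longrightarrow> norm_at E \<epsilon> (x - z) \<le> norm_at E \<epsilon> (x - y) + norm_at E \<epsilon> (y - z)"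
  using norm_at_add[of \<epsilon> "x - y" "y - z"] by (simp add: subspace_diff subspace_space_at)

lemma norm_at_swap: "\<epsilon> \<in> idx \<Longrightarrow> x \<in> space_at E \<epsilon> \<Longrightarrow> y \<in> space_at E \<epsilon> \<Longrightarrow>
    norm_at E \<epsilon> (x - y) = norm_at E \<epsilon> (y - x)"
  using norm_at_minus[of \<epsilon> "x - y"] by (simp add: subspace_diff subspace_space_at)

lemma norm_at_abs_diff: "\<epsilon> \<in> idx \<Longrightarrow> x \<in> space_at E \<epsilon> \<Longrightarrow> y \<in> space_at E \<epsilon> \<Longrightarrow>
    \<bar>norm_at E \<epsilon> x - norm_at E \<epsilon> y\<bar> \<le> norm_at E \<epsilon> (x - y)"
  using norm_at_triangle[of \<epsilon> x y 0] norm_at_triangle[of \<epsilon> y x 0] norm_at_swap[of \<epsilon> x y]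
  by (simp add: subspace_0 subspace_space_at abs_le_iff)

section \<open>Eventual bounds by powers of the gauge\<close>

lemma eventually_index: "\<forall>\<^sub>F \<epsilon> in small L. \<epsilon> \<in> L"
  by (simp add: eventually_at_filter)

lemma eventually_small_mono: "eventually P (small idx) \<Longrightarrow> L \<subseteq> idx \<Longrightarrow> eventually P (small L)"
  by (meson at_le filter_leD)

text \<open>Since \<rho> tends to 0, one extra power absorbs any constant. It removes the constants
  of Landau symbols and the factor 2 left by a triangle inequality. The threshold
  \<open>1 / (\<bar>c\<bar> + 1)\<close> is meaningful for every sign of \<open>c\<close>.\<close>

lemma eventually_rho_power:
  assumes "L \<subseteq> idx"
  shows "\<forall>\<^sub>F \<epsilon> in small L. c * \<rho> \<epsilon> ^ Suc N \<le> \<rho> \<epsilon> ^ N"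
proof -
  have "(\<rho> \<longlongrightarrow> 0) (small idx)"
    using gauge by (simp add: gauge_net_def)
  then have "\<forall>\<^sub>F \<epsilon> in small idx. \<rho> \<epsilon> < 1 / (\<bar>c\<bar> + 1)"
    by (rule order_tendstoD) simp
  then have "\<forall>\<^sub>F \<epsilon> in small L. \<rho> \<epsilon> < 1 / (\<bar>c\<bar> + 1)"
    by (rule eventually_small_mono) fact
  then show ?thesis
    using eventually_index
  proof eventually_elim
    case (elim \<epsilon>)
    then have \<epsilon>: "\<epsilon> \<in> idx" using assms by blast
    have "c * \<rho> \<epsilon> \<le> (\<bar>c\<bar> + 1) * \<rho> \<epsilon>"
      using rho_pos[OF \<epsilon>] by (intro mult_right_mono) auto
    also have "\<dots> \<le> 1"
      using elim(1) by (simp add: field_simps)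
    finally show ?case
      using mult_right_mono[of "c * \<rho> \<epsilon>" 1 "\<rho> \<epsilon> ^ N"] rho_pos[OF \<epsilon>] by (simp add: mult_ac)
  qed
qed

lemma moderateI:
  assumes "L \<subseteq> idx" "u \<in> Pi\<^sub>E L (space_at E)"
    and "\<forall>\<^sub>F \<epsilon> in small L. norm_at E \<epsilon> (u \<epsilon>) \<le> c * inverse (\<rho> \<epsilon>) ^ N"
  shows "u \<in> moderate \<rho> E L"
proof -
  have "(\<lambda>\<epsilon>. norm_at E \<epsilon> (u \<epsilon>)) \<in> O[small L](\<lambda>\<epsilon>. inverse (\<rho> \<epsilon>) ^ N)"
  proof (rule bigoI)
    show "\<forall>\<^sub>F \<epsilon> in small L. norm (norm_at E \<epsilon> (u \<epsilon>)) \<le> c * norm (inverse (\<rho> \<epsilon>) ^ N)"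
      using assms(3) eventually_index
    proof eventually_elim
      case (elim \<epsilon>)
      then show ?case
        using rho_pos[of \<epsilon>] norm_at_nonneg[of \<epsilon> "u \<epsilon>"] assms(1,2)
        by (auto simp: power_abs abs_inverse abs_of_nonneg PiE_iff subset_iff)
    qed
  qed
  then show ?thesis
    using assms(2) by (auto simp: moderate_def)
qed

lemma moderate_in_space: "u \<in> moderate \<rho> E L \<Longrightarrow> \<epsilon> \<in> L \<Longrightarrow> u \<epsilon> \<in> space_at E \<epsilon>"
  by (auto simp: moderate_def)

text \<open>The Landau constant is eventually at most \<open>inverse (\<rho> \<epsilon>)\<close>, so
  raising the exponent by one removes it.\<close>

lemma moderateE:
  assumes "u \<in> moderate \<rho> E L" "L \<subseteq> idx"
  obtains N where "\<forall>\<^sub>F \<epsilon> in small L. norm_at E \<epsilon> (u \<epsilon>) \<le> inverse (\<rho> \<epsilon>) ^ N"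
proof -
  obtain N where "(\<lambda>\<epsilon>. norm_at E \<epsilon> (u \<epsilon>)) \<in> O[small L](\<lambda>\<epsilon>. inverse (\<rho> \<epsilon>) ^ N)"
    using assms(1) by (auto simp: moderate_def)
  then obtain c where c: "\<forall>\<^sub>F \<epsilon> in small L. norm (norm_at E \<epsilon> (u \<epsilon>)) \<le> c * norm (inverse (\<rho> \<epsilon>) ^ N)"
    by (elim landau_o.bigE)
  have "\<forall>\<^sub>F \<epsilon> in small L. norm_at E \<epsilon> (u \<epsilon>) \<le> inverse (\<rho> \<epsilon>) ^ Suc N"
    using c eventually_rho_power[OF assms(2), of c 0] eventually_index
  proof eventually_elim
    case (elim \<epsilon>)
    then have pos: "0 < \<rho> \<epsilon>" using rho_pos assms(2) by blast
    have "norm_at E \<epsilon> (u \<epsilon>) \<le> c * inverse (\<rho> \<epsilon>) ^ N"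
      using elim(1) pos by (simp add: power_abs abs_inverse)
    also have "\<dots> \<le> inverse (\<rho> \<epsilon>) * inverse (\<rho> \<epsilon>) ^ N"
      using elim(2) pos by (intro mult_right_mono) (auto simp: field_simps)
    finally show ?case by simp
  qed
  then show ?thesis by (rule that)
qed

lemma negligible_netsI:
  assumes "L \<subseteq> idx" "u \<in> Pi\<^sub>E L (space_at E)"
    and "\<And>N. \<forall>\<^sub>F \<epsilon> in small L. norm_at E \<epsilon> (u \<epsilon>) \<le> c * \<rho> \<epsilon> ^ N"
  shows "u \<in> negligible_nets \<rho> E L"
proof -
  have "(\<lambda>\<epsilon>. norm_at E \<epsilon> (u \<epsilon>)) \<in> O[small L](\<lambda>\<epsilon>. \<rho> \<epsilon> ^ N)" for N
  proof (rule bigoI)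
    show "\<forall>\<^sub>F \<epsilon> in small L. norm (norm_at E \<epsilon> (u \<epsilon>)) \<le> c * norm (\<rho> \<epsilon> ^ N)"
      using assms(3)[of N] eventually_index
    proof eventually_elim
      case (elim \<epsilon>)
      then show ?case
        using rho_pos[of \<epsilon>] norm_at_nonneg[of \<epsilon> "u \<epsilon>"] assms(1,2)
        by (auto simp: power_abs abs_of_nonneg PiE_iff subset_iff)
    qed
  qed
  then show ?thesis
    unfolding negligible_nets_def using assms(2) by blast
qed

text \<open>The Landau bound is taken at \<open>Suc N\<close>; its surplus factor
  \<open>\<rho> \<epsilon>\<close> pays for the constant.\<close>

lemma negligible_netsD:
  assumes "u \<in> negligible_nets \<rho> E L" "L \<subseteq> idx"
  shows "\<forall>\<^sub>F \<epsilon> in small L. norm_at E \<epsilon> (u \<epsilon>) \<le> \<rho> \<epsilon> ^ N"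
proof -
  have "(\<lambda>\<epsilon>. norm_at E \<epsilon> (u \<epsilon>)) \<in> O[small L](\<lambda>\<epsilon>. \<rho> \<epsilon> ^ Suc N)"
    using assms(1) unfolding negligible_nets_def by blast
  then obtain c where c: "\<forall>\<^sub>F \<epsilon> in small L. norm (norm_at E \<epsilon> (u \<epsilon>)) \<le> c * norm (\<rho> \<epsilon> ^ Suc N)"
    by (elim landau_o.bigE)
  show ?thesis
    using c eventually_rho_power[OF assms(2), of c N] eventually_index
  proof eventually_elim
    case (elim \<epsilon>)
    then have "0 < \<rho> \<epsilon>" using rho_pos assms(2) by blast
    then have "norm (\<rho> \<epsilon> ^ Suc N) = \<rho> \<epsilon> ^ Suc N" by (simp add: less_imp_le)
    with elim(1) have "norm_at E \<epsilon> (u \<epsilon>) \<le> c * \<rho> \<epsilon> ^ Suc N"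
      by (metis abs_ge_self order_trans real_norm_def)
    also note elim(2)
    finally show ?case .
  qed
qed

lemma
  assumes u: "u \<in> moderate \<rho> E idx" and v: "v \<in> moderate \<rho> E idx"
  shows moderate_add: "(\<lambda>\<epsilon>\<in>idx. u \<epsilon> + v \<epsilon>) \<in> moderate \<rho> E idx"
    and moderate_diff: "(\<lambda>\<epsilon>\<in>idx. u \<epsilon> - v \<epsilon>) \<in> moderate \<rho> E idx"
proof -
  obtain M where M: "\<forall>\<^sub>F \<epsilon> in small idx. norm_at E \<epsilon> (u \<epsilon>) \<le> inverse (\<rho> \<epsilon>) ^ M"
    by (rule moderateE[OF u order_refl])
  obtain N where N: "\<forall>\<^sub>F \<epsilon> in small idx. norm_at E \<epsilon> (v \<epsilon>) \<le> inverse (\<rho> \<epsilon>) ^ N"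
    by (rule moderateE[OF v order_refl])
  have bound: "\<forall>\<^sub>F \<epsilon> in small idx.
      norm_at E \<epsilon> (u \<epsilon>) + norm_at E \<epsilon> (v \<epsilon>) \<le> 2 * inverse (\<rho> \<epsilon>) ^ (M + N)"
    using M N eventually_index
  proof eventually_elim
    case (elim \<epsilon>)
    have "inverse (\<rho> \<epsilon>) ^ M \<le> inverse (\<rho> \<epsilon>) ^ (M + N)" "inverse (\<rho> \<epsilon>) ^ N \<le> inverse (\<rho> \<epsilon>) ^ (M + N)"
      using inverse_rho_ge_1[OF elim(3)] by (auto intro: power_increasing)
    with elim show ?case by linarith
  qed
  show "(\<lambda>\<epsilon>\<in>idx. u \<epsilon> + v \<epsilon>) \<in> moderate \<rho> E idx"
  proof (rule moderateI[OF order_refl])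
    show "\<forall>\<^sub>F \<epsilon> in small idx.
        norm_at E \<epsilon> ((\<lambda>\<epsilon>\<in>idx. u \<epsilon> + v \<epsilon>) \<epsilon>) \<le> 2 * inverse (\<rho> \<epsilon>) ^ (M + N)"
      using bound eventually_index
    proof eventually_elim
      case (elim \<epsilon>)
      then show ?case
        using norm_at_add[OF elim(2), of "u \<epsilon>" "v \<epsilon>"]
        by (simp add: moderate_in_space[OF u] moderate_in_space[OF v])
    qed
  qed (auto intro!: subspace_add[OF subspace_space_at] moderate_in_space[OF u] moderate_in_space[OF v])
  show "(\<lambda>\<epsilon>\<in>idx. u \<epsilon> - v \<epsilon>) \<in> moderate \<rho> E idx"
  proof (rule moderateI[OF order_refl])
    show "\<forall>\<^sub>F \<epsilon> in small idx.
        norm_at E \<epsilon> ((\<lambda>\<epsilon>\<in>idx. u \<epsilon> - v \<epsilon>) \<epsilon>) \<le> 2 * inverse (\<rho> \<epsilon>) ^ (M + N)"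
      using bound eventually_index
    proof eventually_elim
      case (elim \<epsilon>)
      then show ?case
        using norm_at_diff[OF elim(2), of "u \<epsilon>" "v \<epsilon>"]
        by (simp add: moderate_in_space[OF u] moderate_in_space[OF v])
    qed
  qed (auto intro!: subspace_diff[OF subspace_space_at] moderate_in_space[OF u] moderate_in_space[OF v])
qed

text \<open>For nets already known to be moderate, Landau symbols disappear from the equivalence.
  Every later equality of classes is verified through this inequality with constant one.\<close>

lemma gen_rel_iff:
  assumes L: "L \<subseteq> idx" and u: "u \<in> moderate \<rho> E L" and v: "v \<in> moderate \<rho> E L"
  shows "(u, v) \<in> gen_rel \<rho> E L \<longleftrightarrow>
    (\<forall>N. \<forall>\<^sub>F \<epsilon> in small L. norm_at E \<epsilon> (u \<epsilon> - v \<epsilon>) \<le> \<rho> \<epsilon> ^ N)" (is "_ = ?R")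
proof
  assume "(u, v) \<in> gen_rel \<rho> E L"
  then have *: "(\<lambda>\<epsilon>\<in>L. u \<epsilon> - v \<epsilon>) \<in> negligible_nets \<rho> E L" by (simp add: gen_rel_def)
  show ?R
  proof
    fix N
    show "\<forall>\<^sub>F \<epsilon> in small L. norm_at E \<epsilon> (u \<epsilon> - v \<epsilon>) \<le> \<rho> \<epsilon> ^ N"
      using negligible_netsD[OF * L, of N] eventually_index by eventually_elim simp
  qed
next
  assume R: ?R
  have "(\<lambda>\<epsilon>\<in>L. u \<epsilon> - v \<epsilon>) \<in> negligible_nets \<rho> E L"
  proof (rule negligible_netsI[OF L, where c = 1])
    show "(\<lambda>\<epsilon>\<in>L. u \<epsilon> - v \<epsilon>) \<in> Pi\<^sub>E L (space_at E)"
      using L by (auto intro!: subspace_diff[OF subspace_space_at] moderate_in_space[OF u]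
          moderate_in_space[OF v])
    show "\<forall>\<^sub>F \<epsilon> in small L. norm_at E \<epsilon> ((\<lambda>\<epsilon>\<in>L. u \<epsilon> - v \<epsilon>) \<epsilon>) \<le> 1 * \<rho> \<epsilon> ^ N" for N
      using spec[OF R, of N] eventually_index by eventually_elim simp
  qed
  then show "(u, v) \<in> gen_rel \<rho> E L"
    using u v by (simp add: gen_rel_def)
qed

lemma equiv_gen_rel:
  assumes L: "L \<subseteq> idx"
  shows "equiv (moderate \<rho> E L) (gen_rel \<rho> E L)"
proof (rule equivI)
  show "gen_rel \<rho> E L \<subseteq> moderate \<rho> E L \<times> moderate \<rho> E L"
    by (auto simp: gen_rel_def)
  show "refl_on (moderate \<rho> E L) (gen_rel \<rho> E L)"
  proof (rule refl_onI)
    fix u assume u: "u \<in> moderate \<rho> E L"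
    have "\<forall>\<^sub>F \<epsilon> in small L. norm_at E \<epsilon> (u \<epsilon> - u \<epsilon>) \<le> \<rho> \<epsilon> ^ N" for N
      using eventually_index
    proof eventually_elim
      case (elim \<epsilon>)
      with L have "\<epsilon> \<in> idx" by blast
      then show ?case using rho_pos[of \<epsilon>] by (simp add: norm_at_zero)
    qed
    then show "(u, u) \<in> gen_rel \<rho> E L" by (simp add: gen_rel_iff[OF L u u])
  qed
  show "sym (gen_rel \<rho> E L)"
  proof (rule symI)
    fix u v assume uv: "(u, v) \<in> gen_rel \<rho> E L"
    then have u: "u \<in> moderate \<rho> E L" and v: "v \<in> moderate \<rho> E L" by (auto simp: gen_rel_def)
    have "\<forall>\<^sub>F \<epsilon> in small L. norm_at E \<epsilon> (v \<epsilon> - u \<epsilon>) \<le> \<rho> \<epsilon> ^ N" for N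
      using uv[unfolded gen_rel_iff[OF L u v], rule_format, of N] eventually_index
    proof eventually_elim
      case (elim \<epsilon>)
      then show ?case
        using L norm_at_swap[of \<epsilon> "v \<epsilon>" "u \<epsilon>"] moderate_in_space[OF u elim(2)]
          moderate_in_space[OF v elim(2)] by (simp add: subset_iff)
    qed
    then show "(v, u) \<in> gen_rel \<rho> E L" by (simp add: gen_rel_iff[OF L v u])
  qed
  show "trans (gen_rel \<rho> E L)"
  proof (rule transI)
    fix u v w assume uv: "(u, v) \<in> gen_rel \<rho> E L" and vw: "(v, w) \<in> gen_rel \<rho> E L"
    then have u: "u \<in> moderate \<rho> E L" and v: "v \<in> moderate \<rho> E L" and w: "w \<in> moderate \<rho> E L"
      by (auto simp: gen_rel_def)
    \<comment> \<open>Both estimates are taken at \<open>Suc N\<close>: their sum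
      \<open>2 * \<rho> \<epsilon> ^ Suc N\<close> is at most \<open>\<rho> \<epsilon> ^ N\<close>
      for small \<epsilon>.\<close>
    have "\<forall>\<^sub>F \<epsilon> in small L. norm_at E \<epsilon> (u \<epsilon> - w \<epsilon>) \<le> \<rho> \<epsilon> ^ N" for N
      using uv[unfolded gen_rel_iff[OF L u v], rule_format, of "Suc N"]
        vw[unfolded gen_rel_iff[OF L v w], rule_format, of "Suc N"]
        eventually_rho_power[OF L, of 2 N] eventually_index
    proof eventually_elim
      case (elim \<epsilon>)
      with L have "\<epsilon> \<in> idx" by blast
      then show ?case
        using elim norm_at_triangle[of \<epsilon> "u \<epsilon>" "v \<epsilon>" "w \<epsilon>"] moderate_in_space[OF u elim(4)]
          moderate_in_space[OF v elim(4)] moderate_in_space[OF w elim(4)] by simp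
    qed
    then show "(u, w) \<in> gen_rel \<rho> E L" by (simp add: gen_rel_iff[OF L u w])
  qed
qed

lemma gen_class_eq_iff:
  assumes "L \<subseteq> idx" "u \<in> moderate \<rho> E L" "v \<in> moderate \<rho> E L"
  shows "gen_class \<rho> E L u = gen_class \<rho> E L v \<longleftrightarrow>
    (\<forall>N. \<forall>\<^sub>F \<epsilon> in small L. norm_at E \<epsilon> (u \<epsilon> - v \<epsilon>) \<le> \<rho> \<epsilon> ^ N)"
  unfolding gen_class_def gen_rel_iff[OF assms, symmetric]
  by (rule eq_equiv_class_iff[OF equiv_gen_rel[OF assms(1)] assms(2,3)])

lemma gen_class_self: "L \<subseteq> idx \<Longrightarrow> u \<in> moderate \<rho> E L \<Longrightarrow> u \<in> gen_class \<rho> E L u"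
  unfolding gen_class_def by (rule equiv_class_self[OF equiv_gen_rel])

lemma gen_class_memD:
  assumes "L \<subseteq> idx" "v \<in> gen_class \<rho> E L u"
  shows "v \<in> moderate \<rho> E L" and "gen_class \<rho> E L v = gen_class \<rho> E L u"
proof -
  have uv: "(u, v) \<in> gen_rel \<rho> E L"
    using assms(2) by (simp add: gen_class_def)
  then show "v \<in> moderate \<rho> E L"
    by (simp add: gen_rel_def)
  show "gen_class \<rho> E L v = gen_class \<rho> E L u"
    unfolding gen_class_def by (rule equiv_class_eq[OF equiv_gen_rel[OF assms(1)] uv, symmetric])
qed

lemma gen_class_in_gen_space: "u \<in> moderate \<rho> E idx \<Longrightarrow> gen_class \<rho> E idx u \<in> gen_space \<rho> E idx"
  by (simp add: gen_space_def gen_class_def quotientI)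

lemma gen_space_cases:
  assumes "x \<in> gen_space \<rho> E idx"
  obtains u where "u \<in> moderate \<rho> E idx" "x = gen_class \<rho> E idx u"
  using assms that unfolding gen_space_def gen_class_def quotient_def by blast

lemma gen_space_memD:
  assumes "x \<in> gen_space \<rho> E idx" "u \<in> x"
  shows "u \<in> moderate \<rho> E idx" and "x = gen_class \<rho> E idx u"
proof -
  obtain v where v: "x = gen_class \<rho> E idx v"
    using assms(1) by (rule gen_space_cases)
  show "u \<in> moderate \<rho> E idx" "x = gen_class \<rho> E idx u"
    using gen_class_memD[OF order_refl assms(2)[unfolded v]] v by simp_all
qed

section \<open>Operations on classes, computed on representatives\<close>

lemma
  assumes "u \<in> moderate \<rho> E idx" "v \<in> moderate \<rho> E idx"
  shows gen_add_class: "gen_add \<rho> E (gen_class \<rho> E idx u) (gen_class \<rho> E idx v) =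
    gen_class \<rho> E idx (\<lambda>\<epsilon>\<in>idx. u \<epsilon> + v \<epsilon>)"
    and gen_diff_class: "gen_diff \<rho> E (gen_class \<rho> E idx u) (gen_class \<rho> E idx v) =
    gen_class \<rho> E idx (\<lambda>\<epsilon>\<in>idx. u \<epsilon> - v \<epsilon>)"
proof -
  have *: "\<forall>\<^sub>F \<epsilon> in small idx. norm_at E \<epsilon> ((\<lambda>\<epsilon>\<in>idx. u' \<epsilon> + v' \<epsilon>) \<epsilon> - (\<lambda>\<epsilon>\<in>idx. u \<epsilon> + v \<epsilon>) \<epsilon>) \<le> \<rho> \<epsilon> ^ N"
    "\<forall>\<^sub>F \<epsilon> in small idx. norm_at E \<epsilon> ((\<lambda>\<epsilon>\<in>idx. u' \<epsilon> - v' \<epsilon>) \<epsilon> - (\<lambda>\<epsilon>\<in>idx. u \<epsilon> - v \<epsilon>) \<epsilon>) \<le> \<rho> \<epsilon> ^ N"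
    if u': "u' \<in> gen_class \<rho> E idx u" and v': "v' \<in> gen_class \<rho> E idx v" for u' v' N
  proof -
    note mu = gen_class_memD(1)[OF order_refl u'] and mv = gen_class_memD(1)[OF order_refl v']
    have ev: "\<forall>\<^sub>F \<epsilon> in small idx. norm_at E \<epsilon> (u' \<epsilon> - u \<epsilon>) \<le> \<rho> \<epsilon> ^ Suc N"
      "\<forall>\<^sub>F \<epsilon> in small idx. norm_at E \<epsilon> (v' \<epsilon> - v \<epsilon>) \<le> \<rho> \<epsilon> ^ Suc N"
      using gen_class_eq_iff[OF order_refl mu assms(1)] gen_class_eq_iff[OF order_refl mv assms(2)]
        gen_class_memD(2)[OF order_refl u'] gen_class_memD(2)[OF order_refl v'] by blast+
    have sp: "u' \<epsilon> - u \<epsilon> \<in> space_at E \<epsilon>" "v' \<epsilon> - v \<epsilon> \<in> space_at E \<epsilon>" if "\<epsilon> \<in> idx" for \<epsilon>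
      using that subspace_diff[OF subspace_space_at] moderate_in_space[OF mu] moderate_in_space[OF mv]
        moderate_in_space[OF assms(1)] moderate_in_space[OF assms(2)] by blast+
    show "\<forall>\<^sub>F \<epsilon> in small idx. norm_at E \<epsilon> ((\<lambda>\<epsilon>\<in>idx. u' \<epsilon> + v' \<epsilon>) \<epsilon> - (\<lambda>\<epsilon>\<in>idx. u \<epsilon> + v \<epsilon>) \<epsilon>) \<le> \<rho> \<epsilon> ^ N"
      using ev eventually_rho_power[OF order_refl, of 2 N] eventually_index
    proof eventually_elim
      case (elim \<epsilon>)
      have "norm_at E \<epsilon> ((u' \<epsilon> + v' \<epsilon>) - (u \<epsilon> + v \<epsilon>)) \<le> \<rho> \<epsilon> ^ N"
        using norm_at_add[OF elim(4) sp[OF elim(4)]] elim(1-3) by (simp add: algebra_simps)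
      then show ?case using elim(4) by simp
    qed
    show "\<forall>\<^sub>F \<epsilon> in small idx. norm_at E \<epsilon> ((\<lambda>\<epsilon>\<in>idx. u' \<epsilon> - v' \<epsilon>) \<epsilon> - (\<lambda>\<epsilon>\<in>idx. u \<epsilon> - v \<epsilon>) \<epsilon>) \<le> \<rho> \<epsilon> ^ N"
      using ev eventually_rho_power[OF order_refl, of 2 N] eventually_index
    proof eventually_elim
      case (elim \<epsilon>)
      have "norm_at E \<epsilon> ((u' \<epsilon> - v' \<epsilon>) - (u \<epsilon> - v \<epsilon>)) \<le> \<rho> \<epsilon> ^ N"
        using norm_at_diff[OF elim(4) sp[OF elim(4)]] elim(1-3) by (simp add: algebra_simps)
      then show ?case using elim(4) by simp
    qed
  qed
  \<comment> \<open>All representatives lead to one class, so the union in the definition of the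
    operation collapses to it; the union is not empty because \<open>u\<close> and \<open>v\<close>
    represent their own classes.\<close>
  have eq: "gen_class \<rho> E idx (\<lambda>\<epsilon>\<in>idx. u' \<epsilon> + v' \<epsilon>) = gen_class \<rho> E idx (\<lambda>\<epsilon>\<in>idx. u \<epsilon> + v \<epsilon>)"
    "gen_class \<rho> E idx (\<lambda>\<epsilon>\<in>idx. u' \<epsilon> - v' \<epsilon>) = gen_class \<rho> E idx (\<lambda>\<epsilon>\<in>idx. u \<epsilon> - v \<epsilon>)"
    if u': "u' \<in> gen_class \<rho> E idx u" and v': "v' \<in> gen_class \<rho> E idx v" for u' v'
    using *[OF u' v'] gen_class_memD(1)[OF order_refl u'] gen_class_memD(1)[OF order_refl v']
    by (simp_all only: gen_class_eq_iff[OF order_refl moderate_add moderate_add]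
          gen_class_eq_iff[OF order_refl moderate_diff moderate_diff] assms simp_thms)
  have self: "u \<in> gen_class \<rho> E idx u" "v \<in> gen_class \<rho> E idx v"
    using assms by (auto intro: gen_class_self)
  show "gen_add \<rho> E (gen_class \<rho> E idx u) (gen_class \<rho> E idx v) =
      gen_class \<rho> E idx (\<lambda>\<epsilon>\<in>idx. u \<epsilon> + v \<epsilon>)"
    using eq(1) self unfolding gen_add_def by blast
  show "gen_diff \<rho> E (gen_class \<rho> E idx u) (gen_class \<rho> E idx v) =
      gen_class \<rho> E idx (\<lambda>\<epsilon>\<in>idx. u \<epsilon> - v \<epsilon>)"
    using eq(2) self unfolding gen_diff_def by blast
qed

lemma generalized_space_real_line: "generalized_space \<rho> real_line"
  using gauge normed_spaces_real_line by unfold_locales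

lemma rho_power_moderate: "(\<lambda>\<epsilon>\<in>idx. c * \<rho> \<epsilon> ^ N) \<in> moderate \<rho> real_line idx"
proof (rule generalized_space.moderateI[OF generalized_space_real_line order_refl, where c = "\<bar>c\<bar>" and N = 0])
  show "\<forall>\<^sub>F \<epsilon> in small idx.
      norm_at real_line \<epsilon> ((\<lambda>\<epsilon>\<in>idx. c * \<rho> \<epsilon> ^ N) \<epsilon>) \<le> \<bar>c\<bar> * inverse (\<rho> \<epsilon>) ^ 0"
    using eventually_index
  proof eventually_elim
    case (elim \<epsilon>)
    then have "\<bar>\<rho> \<epsilon> ^ N\<bar> \<le> 1"
      using rho_pos[OF elim] rho_le_1[OF elim] by (simp add: power_le_one)
    then show ?case
      using elim mult_left_mono[of "\<bar>\<rho> \<epsilon> ^ N\<bar>" 1 "\<bar>c\<bar>"] by (simp add: abs_mult)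
  qed
qed auto

lemma const_moderate: "(\<lambda>\<epsilon>\<in>idx. c) \<in> moderate \<rho> real_line idx"
  using rho_power_moderate[of c 0] by simp

lemma moderate_scale:
  assumes a: "a \<in> moderate \<rho> real_line idx" and u: "u \<in> moderate \<rho> E idx"
  shows "(\<lambda>\<epsilon>\<in>idx. a \<epsilon> *\<^sub>R u \<epsilon>) \<in> moderate \<rho> E idx"
proof -
  obtain M where M: "\<forall>\<^sub>F \<epsilon> in small idx. norm_at real_line \<epsilon> (a \<epsilon>) \<le> inverse (\<rho> \<epsilon>) ^ M"
    by (rule generalized_space.moderateE[OF generalized_space_real_line a order_refl])
  obtain N where N: "\<forall>\<^sub>F \<epsilon> in small idx. norm_at E \<epsilon> (u \<epsilon>) \<le> inverse (\<rho> \<epsilon>) ^ N"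
    by (rule moderateE[OF u order_refl])
  show ?thesis
  proof (rule moderateI[OF order_refl, where c = 1 and N = "M + N"])
    show "\<forall>\<^sub>F \<epsilon> in small idx.
        norm_at E \<epsilon> ((\<lambda>\<epsilon>\<in>idx. a \<epsilon> *\<^sub>R u \<epsilon>) \<epsilon>) \<le> 1 * inverse (\<rho> \<epsilon>) ^ (M + N)"
      using M N eventually_index
    proof eventually_elim
      case (elim \<epsilon>)
      note sp = moderate_in_space[OF u elim(3)]
      have "\<bar>a \<epsilon>\<bar> * norm_at E \<epsilon> (u \<epsilon>) \<le> inverse (\<rho> \<epsilon>) ^ M * inverse (\<rho> \<epsilon>) ^ N"
        using elim rho_pos[OF elim(3)] norm_at_nonneg[OF elim(3) sp]
        by (intro mult_mono) auto
      then show ?case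
        using elim(3) norm_at_scale[OF elim(3) sp] by (simp add: power_add)
    qed
  qed (auto intro!: subspace_scale[OF subspace_space_at] moderate_in_space[OF u])
qed

lemma gen_scale_class:
  assumes a: "a \<in> moderate \<rho> real_line idx" and u: "u \<in> moderate \<rho> E idx"
  shows "gen_scale \<rho> E (gen_class \<rho> real_line idx a) (gen_class \<rho> E idx u) =
    gen_class \<rho> E idx (\<lambda>\<epsilon>\<in>idx. a \<epsilon> *\<^sub>R u \<epsilon>)"
proof -
  interpret real: generalized_space \<rho> real_line by (rule generalized_space_real_line)
  have "gen_class \<rho> E idx (\<lambda>\<epsilon>\<in>idx. b \<epsilon> *\<^sub>R v \<epsilon>) = gen_class \<rho> E idx (\<lambda>\<epsilon>\<in>idx. a \<epsilon> *\<^sub>R u \<epsilon>)"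
    if b: "b \<in> gen_class \<rho> real_line idx a" and v: "v \<in> gen_class \<rho> E idx u" for b v
  proof -
    note mb = real.gen_class_memD(1)[OF order_refl b] and mv = gen_class_memD(1)[OF order_refl v]
    have ba: "\<forall>\<^sub>F \<epsilon> in small idx. \<bar>b \<epsilon> - a \<epsilon>\<bar> \<le> \<rho> \<epsilon> ^ K" for K
      using real.gen_class_eq_iff[OF order_refl mb a] real.gen_class_memD(2)[OF order_refl b] by simp
    have vu: "\<forall>\<^sub>F \<epsilon> in small idx. norm_at E \<epsilon> (v \<epsilon> - u \<epsilon>) \<le> \<rho> \<epsilon> ^ K" for K
      using gen_class_eq_iff[OF order_refl mv u] gen_class_memD(2)[OF order_refl v] by simp
    obtain M where M: "\<forall>\<^sub>F \<epsilon> in small idx. norm_at real_line \<epsilon> (b \<epsilon>) \<le> inverse (\<rho> \<epsilon>) ^ M"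
      by (rule real.moderateE[OF mb order_refl])
    obtain N where N: "\<forall>\<^sub>F \<epsilon> in small idx. norm_at E \<epsilon> (u \<epsilon>) \<le> inverse (\<rho> \<epsilon>) ^ N"
      by (rule moderateE[OF u order_refl])
    \<comment> \<open>The difference of products splits into
      \<open>b \<epsilon> *\<^sub>R (v \<epsilon> - u \<epsilon>)\<close> and
      \<open>(b \<epsilon> - a \<epsilon>) *\<^sub>R u \<epsilon>\<close>. The precision demanded of
      each small factor is the growth exponent of the other factor (\<open>M\<close> for
      \<open>b\<close>, \<open>N\<close> for \<open>u\<close>) plus \<open>Suc K\<close>; the
      surplus power absorbs the 2 arising from the sum.\<close>
    have "\<forall>\<^sub>F \<epsilon> in small idx.
        norm_at E \<epsilon> ((\<lambda>\<epsilon>\<in>idx. b \<epsilon> *\<^sub>R v \<epsilon>) \<epsilon> - (\<lambda>\<epsilon>\<in>idx. a \<epsilon> *\<^sub>R u \<epsilon>) \<epsilon>) \<le> \<rho> \<epsilon> ^ K" for K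
      using ba[of "N + Suc K"] vu[of "M + Suc K"] M N eventually_rho_power[OF order_refl, of 2 K]
        eventually_index
    proof eventually_elim
      case (elim \<epsilon>)
      note \<epsilon> = elim(6)
      have pos: "0 < \<rho> \<epsilon>" by (rule rho_pos[OF \<epsilon>])
      have cancel: "inverse (\<rho> \<epsilon>) ^ n * \<rho> \<epsilon> ^ (n + Suc K) = \<rho> \<epsilon> ^ Suc K" for n
        using pos by (simp add: power_add power_inverse)
      note su = moderate_in_space[OF u \<epsilon>]
      have svu: "v \<epsilon> - u \<epsilon> \<in> space_at E \<epsilon>"
        using moderate_in_space[OF mv \<epsilon>] su by (rule subspace_diff[OF subspace_space_at[OF \<epsilon>]])
      have "b \<epsilon> *\<^sub>R v \<epsilon> - a \<epsilon> *\<^sub>R u \<epsilon> = b \<epsilon> *\<^sub>R (v \<epsilon> - u \<epsilon>) + (b \<epsilon> - a \<epsilon>) *\<^sub>R u \<epsilon>"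
        by (simp add: algebra_simps)
      also have "norm_at E \<epsilon> \<dots> \<le> norm_at E \<epsilon> (b \<epsilon> *\<^sub>R (v \<epsilon> - u \<epsilon>)) + norm_at E \<epsilon> ((b \<epsilon> - a \<epsilon>) *\<^sub>R u \<epsilon>)"
        using svu su by (intro norm_at_add[OF \<epsilon>] subspace_scale[OF subspace_space_at[OF \<epsilon>]])
      also have "\<dots> = \<bar>b \<epsilon>\<bar> * norm_at E \<epsilon> (v \<epsilon> - u \<epsilon>) + \<bar>b \<epsilon> - a \<epsilon>\<bar> * norm_at E \<epsilon> (u \<epsilon>)"
        using norm_at_scale[OF \<epsilon>] svu su by simp
      also have "\<dots> \<le> inverse (\<rho> \<epsilon>) ^ M * \<rho> \<epsilon> ^ (M + Suc K) + \<rho> \<epsilon> ^ (N + Suc K) * inverse (\<rho> \<epsilon>) ^ N"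
        using elim(1-4) pos norm_at_nonneg[OF \<epsilon> su] norm_at_nonneg[OF \<epsilon> svu]
        by (intro add_mono mult_mono) auto
      also have "\<dots> = 2 * \<rho> \<epsilon> ^ Suc K"
        using cancel[of M] cancel[of N] by (simp only: mult.commute[of "\<rho> \<epsilon> ^ (N + Suc K)"])
      also note elim(5)
      finally show ?case using \<epsilon> by simp
    qed
    then show ?thesis
      by (simp only: gen_class_eq_iff[OF order_refl moderate_scale[OF mb mv] moderate_scale[OF a u]] simp_thms)
  qed
  moreover have "a \<in> gen_class \<rho> real_line idx a" "u \<in> gen_class \<rho> E idx u"
    using a u real.gen_class_self gen_class_self by auto
  ultimately show ?thesis
    unfolding gen_scale_def by blast
qed

text \<open>Independence of the representative is the reverse triangle inequality.\<close>

lemma gen_norm_class: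
  assumes u: "u \<in> moderate \<rho> E idx"
  shows "(\<lambda>\<epsilon>\<in>idx. norm_at E \<epsilon> (u \<epsilon>)) \<in> moderate \<rho> real_line idx" (is "?N u \<in> _")
    and "gen_norm \<rho> E (gen_class \<rho> E idx u) = gen_class \<rho> real_line idx (\<lambda>\<epsilon>\<in>idx. norm_at E \<epsilon> (u \<epsilon>))"
proof -
  interpret real: generalized_space \<rho> real_line by (rule generalized_space_real_line)
  have mod: "?N v \<in> moderate \<rho> real_line idx" if v: "v \<in> moderate \<rho> E idx" for v
  proof -
    obtain N where N: "\<forall>\<^sub>F \<epsilon> in small idx. norm_at E \<epsilon> (v \<epsilon>) \<le> inverse (\<rho> \<epsilon>) ^ N"
      by (rule moderateE[OF v order_refl])
    show ?thesis
    proof (rule real.moderateI[OF order_refl, where c = 1 and N = N])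
      show "\<forall>\<^sub>F \<epsilon> in small idx. norm_at real_line \<epsilon> (?N v \<epsilon>) \<le> 1 * inverse (\<rho> \<epsilon>) ^ N"
        using N eventually_index
      proof eventually_elim
        case (elim \<epsilon>)
        then show ?case
          using norm_at_nonneg[OF elim(2) moderate_in_space[OF v elim(2)]] by simp
      qed
    qed auto
  qed
  show "?N u \<in> moderate \<rho> real_line idx" by (rule mod[OF u])
  have "gen_class \<rho> real_line idx (?N v) = gen_class \<rho> real_line idx (?N u)"
    if v: "v \<in> gen_class \<rho> E idx u" for v
  proof -
    note mv = gen_class_memD(1)[OF order_refl v]
    have vu: "\<forall>\<^sub>F \<epsilon> in small idx. norm_at E \<epsilon> (v \<epsilon> - u \<epsilon>) \<le> \<rho> \<epsilon> ^ K" for K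
      using gen_class_eq_iff[OF order_refl mv u] gen_class_memD(2)[OF order_refl v] by simp
    have "\<forall>\<^sub>F \<epsilon> in small idx. norm_at real_line \<epsilon> (?N v \<epsilon> - ?N u \<epsilon>) \<le> \<rho> \<epsilon> ^ K" for K
      using vu[of K] eventually_index
    proof eventually_elim
      case (elim \<epsilon>)
      then show ?case
        using norm_at_abs_diff[OF elim(2) moderate_in_space[OF mv elim(2)] moderate_in_space[OF u elim(2)]]
        by simp
    qed
    then show ?thesis
      by (simp only: real.gen_class_eq_iff[OF order_refl mod[OF mv] mod[OF u]] simp_thms)
  qed
  then show "gen_norm \<rho> E (gen_class \<rho> E idx u) = gen_class \<rho> real_line idx (?N u)"
    unfolding gen_norm_def using gen_class_self[OF order_refl u] by (intro SUP_eq_const) blast+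
qed

end

subsection \<open>Order on the generalized reals\<close>

context generalized_space
begin

interpretation real: generalized_space \<rho> real_line
  by (rule generalized_space_real_line)

text \<open>The order asks for a majorant of every representative \<open>u'\<close> of the smaller
  class. As \<open>u'\<close> differs from \<open>u\<close> by a negligible net, adding that net to
  \<open>v\<close> gives a majorant in the same class as \<open>v\<close>.\<close>

lemma gen_le_classI:
  assumes u: "u \<in> moderate \<rho> real_line idx" and v: "v \<in> moderate \<rho> real_line idx"
    and le: "\<forall>\<^sub>F \<epsilon> in small idx. u \<epsilon> \<le> v \<epsilon>"
  shows "gen_le (gen_class \<rho> real_line idx u) (gen_class \<rho> real_line idx v)"
  unfolding gen_le_def
proof
  fix u' assume u': "u' \<in> gen_class \<rho> real_line idx u"
  note mu' = real.gen_class_memD(1)[OF order_refl u']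
  define d where "d = (\<lambda>\<epsilon>\<in>idx. u' \<epsilon> - u \<epsilon>)"
  define v' where "v' = (\<lambda>\<epsilon>\<in>idx. v \<epsilon> + d \<epsilon>)"
  have mv': "v' \<in> moderate \<rho> real_line idx"
    unfolding v'_def d_def by (intro real.moderate_add real.moderate_diff mu' u v)
  have "\<forall>\<^sub>F \<epsilon> in small idx. norm_at real_line \<epsilon> (v' \<epsilon> - v \<epsilon>) \<le> \<rho> \<epsilon> ^ K" for K
    using real.gen_class_eq_iff[OF order_refl mu' u, THEN iffD1, OF real.gen_class_memD(2)[OF order_refl u'],
        rule_format, of K] eventually_index
    by eventually_elim (simp add: v'_def d_def)
  then have "gen_class \<rho> real_line idx v' = gen_class \<rho> real_line idx v"
    by (simp only: real.gen_class_eq_iff[OF order_refl mv' v] simp_thms)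
  moreover have "\<forall>\<^sub>F \<epsilon> in small idx. u' \<epsilon> \<le> v' \<epsilon>"
    using le eventually_index by eventually_elim (simp add: v'_def d_def)
  ultimately show "\<exists>v\<in>gen_class \<rho> real_line idx v. \<forall>\<^sub>F \<epsilon> in small idx. u' \<epsilon> \<le> v \<epsilon>"
    using real.gen_class_self[OF order_refl mv'] by metis
qed

lemma gen_const_class: "gen_const \<rho> c = gen_class \<rho> real_line idx (\<lambda>\<epsilon>\<in>idx. c)"
  by (simp add: gen_const_def)

text \<open>A moderate inverse cannot grow faster than some power of
  \<open>inverse (\<rho> \<epsilon>)\<close>, which keeps \<open>\<bar>w \<epsilon>\<bar>\<close>
  above a power of \<rho>; nonnegativity up to a negligible error then decides the sign. Conversely,
  such a lower bound makes the pointwise inverse moderate.\<close>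

lemma gen_pos_iff:
  assumes w: "w \<in> moderate \<rho> real_line idx"
  shows "gen_pos \<rho> (gen_class \<rho> real_line idx w) \<longleftrightarrow> (\<exists>n. \<forall>\<^sub>F \<epsilon> in small idx. \<rho> \<epsilon> ^ n \<le> w \<epsilon>)"
proof
  assume pos: "gen_pos \<rho> (gen_class \<rho> real_line idx w)"
  have "(\<lambda>\<epsilon>\<in>idx. 0) \<in> gen_const \<rho> 0"
    unfolding gen_const_class by (rule real.gen_class_self[OF order_refl const_moderate])
  then obtain v where v: "v \<in> gen_class \<rho> real_line idx w"
    and ev: "\<forall>\<^sub>F \<epsilon> in small idx. (\<lambda>\<epsilon>\<in>idx. 0) \<epsilon> \<le> v \<epsilon>"
    using pos unfolding gen_pos_def gen_le_def by blast
  note mv = real.gen_class_memD(1)[OF order_refl v]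
  have vw: "\<forall>\<^sub>F \<epsilon> in small idx. \<bar>v \<epsilon> - w \<epsilon>\<bar> \<le> \<rho> \<epsilon> ^ K" for K
    using real.gen_class_eq_iff[OF order_refl mv w] real.gen_class_memD(2)[OF order_refl v] by simp
  obtain y where y: "y \<in> gen_reals \<rho>" "gen_scale \<rho> real_line (gen_class \<rho> real_line idx w) y = gen_const \<rho> 1"
    using pos unfolding gen_pos_def gen_invertible_def by blast
  obtain z where z: "z \<in> moderate \<rho> real_line idx" "y = gen_class \<rho> real_line idx z"
    using y(1) by (rule real.gen_space_cases)
  have "gen_class \<rho> real_line idx (\<lambda>\<epsilon>\<in>idx. w \<epsilon> *\<^sub>R z \<epsilon>) = gen_class \<rho> real_line idx (\<lambda>\<epsilon>\<in>idx. 1)"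
    using y(2) real.gen_scale_class[OF w z(1)] by (simp add: z(2) gen_const_class)
  then have wz: "\<forall>\<^sub>F \<epsilon> in small idx. norm_at real_line \<epsilon>
      ((\<lambda>\<epsilon>\<in>idx. w \<epsilon> *\<^sub>R z \<epsilon>) \<epsilon> - (\<lambda>\<epsilon>\<in>idx. 1) \<epsilon>) \<le> \<rho> \<epsilon> ^ 1"
    using real.gen_class_eq_iff[OF order_refl real.moderate_scale[OF w z(1)] const_moderate] by blast
  obtain M where M: "\<forall>\<^sub>F \<epsilon> in small idx. norm_at real_line \<epsilon> (z \<epsilon>) \<le> inverse (\<rho> \<epsilon>) ^ M"
    by (rule real.moderateE[OF z(1) order_refl])
  \<comment> \<open>For small \<epsilon> the product \<open>w \<epsilon> * z \<epsilon>\<close> is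
    within 1/2 of 1, whence \<open>\<bar>w \<epsilon>\<bar> \<ge> \<rho> \<epsilon> ^ Suc M\<close>.
    The error between \<open>v\<close> and \<open>w\<close> is taken one power smaller, so
    \<open>w \<epsilon> \<ge> - (\<rho> \<epsilon> ^ Suc (Suc M))\<close>, and a negative
    \<open>w \<epsilon>\<close> is impossible.\<close>
  have "\<forall>\<^sub>F \<epsilon> in small idx. \<rho> \<epsilon> ^ Suc M \<le> w \<epsilon>"
    using ev vw[of "Suc (Suc M)"] wz M eventually_rho_power[OF order_refl, of 2 0]
      eventually_rho_power[OF order_refl, of 2 M] eventually_rho_power[OF order_refl, of 2 "Suc M"]
      eventually_index
  proof eventually_elim
    case (elim \<epsilon>)
    note \<epsilon> = elim(8)
    have pos: "0 < \<rho> \<epsilon>" by (rule rho_pos[OF \<epsilon>])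
    have "1 / 2 \<le> \<bar>w \<epsilon>\<bar> * \<bar>z \<epsilon>\<bar>"
      using elim(3,5) \<epsilon> by (simp add: abs_mult[symmetric])
    also have "\<dots> \<le> \<bar>w \<epsilon>\<bar> * inverse (\<rho> \<epsilon>) ^ M"
      using elim(4) by (intro mult_left_mono) auto
    finally have "\<rho> \<epsilon> ^ M \<le> 2 * \<bar>w \<epsilon>\<bar>"
      using pos by (simp add: field_simps)
    then have "\<rho> \<epsilon> ^ Suc M \<le> \<bar>w \<epsilon>\<bar>"
      using elim(6) by linarith
    moreover have "- (\<rho> \<epsilon> ^ Suc (Suc M)) \<le> w \<epsilon>"
      using elim(1,2) \<epsilon> by (simp add: abs_le_iff)
    moreover have "0 < \<rho> \<epsilon> ^ Suc M"
      using pos by simp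
    ultimately show ?case using elim(7) by linarith
  qed
  then show "\<exists>n. \<forall>\<^sub>F \<epsilon> in small idx. \<rho> \<epsilon> ^ n \<le> w \<epsilon>" by blast
next
  assume "\<exists>n. \<forall>\<^sub>F \<epsilon> in small idx. \<rho> \<epsilon> ^ n \<le> w \<epsilon>"
  then obtain n where n: "\<forall>\<^sub>F \<epsilon> in small idx. \<rho> \<epsilon> ^ n \<le> w \<epsilon>" by blast
  have n': "\<forall>\<^sub>F \<epsilon> in small idx. 0 < w \<epsilon>"
    using n eventually_index by eventually_elim (meson rho_pos zero_less_power less_le_trans)
  \<comment> \<open>Where \<open>w\<close> vanishes this net has the default value 0; that can
    happen only away from small \<epsilon>, by \<open>n'\<close>.\<close>
  define z where "z = (\<lambda>\<epsilon>\<in>idx. inverse (w \<epsilon>))"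
  have z: "z \<in> moderate \<rho> real_line idx"
  proof (rule real.moderateI[OF order_refl, where c = 1 and N = n])
    show "\<forall>\<^sub>F \<epsilon> in small idx. norm_at real_line \<epsilon> (z \<epsilon>) \<le> 1 * inverse (\<rho> \<epsilon>) ^ n"
      using n n' eventually_index
    proof eventually_elim
      case (elim \<epsilon>)
      have "inverse (w \<epsilon>) \<le> inverse (\<rho> \<epsilon> ^ n)"
        using elim rho_pos[OF elim(3)] by (intro le_imp_inverse_le) auto
      then show ?case using elim by (simp add: z_def power_inverse)
    qed
  qed (simp add: z_def)
  have "\<forall>\<^sub>F \<epsilon> in small idx. norm_at real_line \<epsilon>
      ((\<lambda>\<epsilon>\<in>idx. w \<epsilon> *\<^sub>R z \<epsilon>) \<epsilon> - (\<lambda>\<epsilon>\<in>idx. 1) \<epsilon>) \<le> \<rho> \<epsilon> ^ K" for K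
    using n' eventually_index
    by eventually_elim (use rho_pos in \<open>auto simp: z_def less_imp_le\<close>)
  then have "gen_class \<rho> real_line idx (\<lambda>\<epsilon>\<in>idx. w \<epsilon> *\<^sub>R z \<epsilon>) = gen_const \<rho> 1"
    unfolding gen_const_class
    by (simp only: real.gen_class_eq_iff[OF order_refl real.moderate_scale[OF w z] const_moderate] simp_thms)
  then have "gen_invertible \<rho> (gen_class \<rho> real_line idx w)"
    unfolding gen_invertible_def using real.gen_scale_class[OF w z] real.gen_class_in_gen_space[OF z] by metis
  moreover have "gen_le (gen_const \<rho> 0) (gen_class \<rho> real_line idx w)"
    unfolding gen_const_class
  proof (rule gen_le_classI[OF const_moderate w])
    show "\<forall>\<^sub>F \<epsilon> in small idx. (\<lambda>\<epsilon>\<in>idx. 0) \<epsilon> \<le> w \<epsilon>"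
      using n' eventually_index by eventually_elim simp
  qed
  ultimately show "gen_pos \<rho> (gen_class \<rho> real_line idx w)"
    by (simp add: gen_pos_def)
qed

text \<open>A strict inequality of generalized reals means a margin of some power of \<rho>. The
  exponent \<open>n\<close> is existential: it depends on the point of the ball, and this margin is
  the room used for openness.\<close>

lemma sharp_ball_iff:
  assumes u: "u \<in> moderate \<rho> E idx" and v: "v \<in> moderate \<rho> E idx" and r: "r \<in> moderate \<rho> real_line idx"
  shows "gen_class \<rho> E idx v \<in> sharp_ball \<rho> E (gen_class \<rho> E idx u) (gen_class \<rho> real_line idx r) \<longleftrightarrow>
    (\<exists>n. \<forall>\<^sub>F \<epsilon> in small idx. norm_at E \<epsilon> (u \<epsilon> - v \<epsilon>) + \<rho> \<epsilon> ^ n \<le> r \<epsilon>)"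
proof -
  note uv = moderate_diff[OF u v]
  note nuv = gen_norm_class[OF uv]
  have "gen_class \<rho> E idx v \<in> sharp_ball \<rho> E (gen_class \<rho> E idx u) (gen_class \<rho> real_line idx r) \<longleftrightarrow>
    gen_pos \<rho> (gen_class \<rho> real_line idx
      (\<lambda>\<epsilon>\<in>idx. r \<epsilon> - (\<lambda>\<epsilon>\<in>idx. norm_at E \<epsilon> ((\<lambda>\<epsilon>\<in>idx. u \<epsilon> - v \<epsilon>) \<epsilon>)) \<epsilon>))"
    by (simp only: sharp_ball_def mem_Collect_eq gen_class_in_gen_space[OF v] simp_thms gen_less_def
        gen_diff_class[OF u v] nuv(2) real.gen_diff_class[OF r nuv(1)])
  also have "\<dots> \<longleftrightarrow> (\<exists>n. \<forall>\<^sub>F \<epsilon> in small idx. \<rho> \<epsilon> ^ n \<le>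
      (\<lambda>\<epsilon>\<in>idx. r \<epsilon> - (\<lambda>\<epsilon>\<in>idx. norm_at E \<epsilon> ((\<lambda>\<epsilon>\<in>idx. u \<epsilon> - v \<epsilon>) \<epsilon>)) \<epsilon>) \<epsilon>)"
    by (rule gen_pos_iff[OF real.moderate_diff[OF r nuv(1)]])
  also have "\<dots> \<longleftrightarrow> (\<exists>n. \<forall>\<^sub>F \<epsilon> in small idx. norm_at E \<epsilon> (u \<epsilon> - v \<epsilon>) + \<rho> \<epsilon> ^ n \<le> r \<epsilon>)"
  proof (rule ex_cong1)
    show "(\<forall>\<^sub>F \<epsilon> in small idx. \<rho> \<epsilon> ^ n \<le>
      (\<lambda>\<epsilon>\<in>idx. r \<epsilon> - (\<lambda>\<epsilon>\<in>idx. norm_at E \<epsilon> ((\<lambda>\<epsilon>\<in>idx. u \<epsilon> - v \<epsilon>) \<epsilon>)) \<epsilon>) \<epsilon>) \<longleftrightarrow>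
      (\<forall>\<^sub>F \<epsilon> in small idx. norm_at E \<epsilon> (u \<epsilon> - v \<epsilon>) + \<rho> \<epsilon> ^ n \<le> r \<epsilon>)" for n
      by (rule eventually_cong[OF eventually_index]) auto
  qed
  finally show ?thesis .
qed

end

subsection \<open>Sharp topology\<close>

context generalized_space
begin

interpretation real: generalized_space \<rho> real_line
  by (rule generalized_space_real_line)

lemma openin_sharp_ball:
  assumes "u \<in> gen_space \<rho> E idx" "r \<in> moderate \<rho> real_line idx" "\<forall>\<^sub>F \<epsilon> in small idx. \<rho> \<epsilon> ^ n \<le> r \<epsilon>"
  shows "openin (sharp_topology \<rho> E) (sharp_ball \<rho> E u (gen_class \<rho> real_line idx r))"
  unfolding sharp_topology_def
  using assms gen_pos_iff[OF assms(2)] real.gen_class_in_gen_space[OF assms(2)]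
  by (intro topology_generated_by_Basis) blast

lemma centre_in_sharp_ball:
  assumes u: "u \<in> moderate \<rho> E idx" and r: "r \<in> moderate \<rho> real_line idx"
    and n: "\<forall>\<^sub>F \<epsilon> in small idx. \<rho> \<epsilon> ^ n \<le> r \<epsilon>"
  shows "gen_class \<rho> E idx u \<in> sharp_ball \<rho> E (gen_class \<rho> E idx u) (gen_class \<rho> real_line idx r)"
proof -
  have "\<forall>\<^sub>F \<epsilon> in small idx. norm_at E \<epsilon> (u \<epsilon> - u \<epsilon>) + \<rho> \<epsilon> ^ n \<le> r \<epsilon>"
    using n eventually_index by eventually_elim (simp add: norm_at_zero)
  then show ?thesis unfolding sharp_ball_iff[OF u u r] by blast
qed

lemma topspace_sharp_topology: "topspace (sharp_topology \<rho> E) = gen_space \<rho> E idx"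
proof
  show "topspace (sharp_topology \<rho> E) \<subseteq> gen_space \<rho> E idx"
    unfolding sharp_topology_def topology_generated_by_topspace by (auto simp: sharp_ball_def)
  show "gen_space \<rho> E idx \<subseteq> topspace (sharp_topology \<rho> E)"
  proof
    fix x assume x: "x \<in> gen_space \<rho> E idx"
    then obtain u where u: "u \<in> moderate \<rho> E idx" "x = gen_class \<rho> E idx u"
      by (rule gen_space_cases)
    have "\<forall>\<^sub>F \<epsilon> in small idx. \<rho> \<epsilon> ^ 0 \<le> (\<lambda>\<epsilon>\<in>idx. 1) \<epsilon>"
      using eventually_index by eventually_elim simp
    with x u show "x \<in> topspace (sharp_topology \<rho> E)"
      using openin_sharp_ball[OF x const_moderate] centre_in_sharp_ball[OF u(1) const_moderate]
      by (metis openin_subset subsetD)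
  qed
qed

text \<open>With the continuity of the functional this makes hyperplanes closed, as preimages of
  single generalized reals.\<close>

lemma closedin_sharp_topology_singleton:
  assumes x: "x \<in> gen_space \<rho> E idx"
  shows "closedin (sharp_topology \<rho> E) {x}"
  unfolding closedin_def
proof (intro conjI)
  show "{x} \<subseteq> topspace (sharp_topology \<rho> E)"
    using x by (simp add: topspace_sharp_topology)
  obtain u where u: "u \<in> moderate \<rho> E idx" "x = gen_class \<rho> E idx u"
    using x by (rule gen_space_cases)
  show "openin (sharp_topology \<rho> E) (topspace (sharp_topology \<rho> E) - {x})"
  proof (subst openin_subopen, intro ballI)
    fix y assume y: "y \<in> topspace (sharp_topology \<rho> E) - {x}"
    then have y': "y \<in> gen_space \<rho> E idx" by (simp add: topspace_sharp_topology)
    then obtain v where v: "v \<in> moderate \<rho> E idx" "y = gen_class \<rho> E idx v"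
      by (rule gen_space_cases)
    \<comment> \<open>Distinctness only says that some power bound fails at arbitrarily small
      indices. This suffices for the ball of radius \<open>\<rho> \<epsilon> ^ N\<close> about
      \<open>y\<close> to miss \<open>x\<close>, since membership would impose the bound at all
      small \<epsilon>.\<close>
    obtain N where N: "\<not> (\<forall>\<^sub>F \<epsilon> in small idx. norm_at E \<epsilon> (v \<epsilon> - u \<epsilon>) \<le> \<rho> \<epsilon> ^ N)"
      using y gen_class_eq_iff[OF order_refl v(1) u(1)] u(2) v(2) by blast
    define r where "r = (\<lambda>\<epsilon>\<in>idx. 1 * \<rho> \<epsilon> ^ N)"
    have r: "r \<in> moderate \<rho> real_line idx"
      unfolding r_def by (rule rho_power_moderate)
    have rN: "\<forall>\<^sub>F \<epsilon> in small idx. \<rho> \<epsilon> ^ N \<le> r \<epsilon>"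
      using eventually_index by eventually_elim (simp add: r_def)
    let ?B = "sharp_ball \<rho> E y (gen_class \<rho> real_line idx r)"
    have "x \<notin> ?B"
    proof
      assume "x \<in> ?B"
      then obtain n where n: "\<forall>\<^sub>F \<epsilon> in small idx. norm_at E \<epsilon> (v \<epsilon> - u \<epsilon>) + \<rho> \<epsilon> ^ n \<le> r \<epsilon>"
        using sharp_ball_iff[OF v(1) u(1) r] u(2) v(2) by blast
      have "\<forall>\<^sub>F \<epsilon> in small idx. norm_at E \<epsilon> (v \<epsilon> - u \<epsilon>) \<le> \<rho> \<epsilon> ^ N"
        using n eventually_index
      proof eventually_elim
        case (elim \<epsilon>)
        then have "0 < \<rho> \<epsilon> ^ n" using rho_pos[OF elim(2)] by simp
        then show ?case using elim by (simp add: r_def)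
      qed
      with N show False by contradiction
    qed
    moreover have "openin (sharp_topology \<rho> E) ?B"
      by (rule openin_sharp_ball[OF y' r rN])
    moreover have "y \<in> ?B"
      using centre_in_sharp_ball[OF v(1) r rN] by (simp add: v(2))
    ultimately show "\<exists>T. openin (sharp_topology \<rho> E) T \<and> y \<in> T \<and> T \<subseteq> topspace (sharp_topology \<rho> E) - {x}"
      using openin_subset by blast
  qed
qed

end

subsection \<open>Nets of functionals of norm at most one\<close>

definition net_map ::
  "(real \<Rightarrow> real) \<Rightarrow> (real \<Rightarrow> 'a \<Rightarrow> real) \<Rightarrow> (real \<Rightarrow> 'a) set \<Rightarrow> (real \<Rightarrow> real) set" where
  "net_map \<rho> F x = (\<Union>u\<in>x. gen_class \<rho> real_line idx (\<lambda>\<epsilon>\<in>idx. F \<epsilon> (u \<epsilon>)))"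

text \<open>Linearity holds on the whole ambient space, the bound only on the fibre, because
  \<open>norm_at E \<epsilon>\<close> is unconstrained elsewhere. The bound one, uniform in
  \<epsilon>, makes every \<open>F \<epsilon>\<close> nonexpansive, so estimates carry over without
  any loss of exponent.\<close>

locale functional_net = generalized_space \<rho> E
  for \<rho> and E :: "'a::real_vector normed_family" +
  fixes F :: "real \<Rightarrow> 'a \<Rightarrow> real"
  assumes linear_F: "\<epsilon> \<in> idx \<Longrightarrow> linear (F \<epsilon>)"
    and F_le_norm: "\<epsilon> \<in> idx \<Longrightarrow> x \<in> space_at E \<epsilon> \<Longrightarrow> \<bar>F \<epsilon> x\<bar> \<le> norm_at E \<epsilon> x"
begin

interpretation real: generalized_space \<rho> real_line
  by (rule generalized_space_real_line)

lemma F_moderate: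
  assumes u: "u \<in> moderate \<rho> E idx"
  shows "(\<lambda>\<epsilon>\<in>idx. F \<epsilon> (u \<epsilon>)) \<in> moderate \<rho> real_line idx"
proof -
  obtain N where N: "\<forall>\<^sub>F \<epsilon> in small idx. norm_at E \<epsilon> (u \<epsilon>) \<le> inverse (\<rho> \<epsilon>) ^ N"
    by (rule moderateE[OF u order_refl])
  show ?thesis
  proof (rule real.moderateI[OF order_refl, where c = 1 and N = N])
    show "\<forall>\<^sub>F \<epsilon> in small idx. norm_at real_line \<epsilon> ((\<lambda>\<epsilon>\<in>idx. F \<epsilon> (u \<epsilon>)) \<epsilon>) \<le> 1 * inverse (\<rho> \<epsilon>) ^ N"
      using N eventually_index
    proof eventually_elim
      case (elim \<epsilon>)
      then show ?case
        using F_le_norm[OF elim(2) moderate_in_space[OF u elim(2)]] by simp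
    qed
  qed auto
qed

lemma F_negligible:
  assumes u: "u \<in> negligible_nets \<rho> E idx"
  shows "(\<lambda>\<epsilon>\<in>idx. F \<epsilon> (u \<epsilon>)) \<in> negligible_nets \<rho> real_line idx"
proof (rule real.negligible_netsI[OF order_refl, where c = 1])
  have sp: "u \<epsilon> \<in> space_at E \<epsilon>" if "\<epsilon> \<in> idx" for \<epsilon>
    using u that unfolding negligible_nets_def by blast
  show "\<forall>\<^sub>F \<epsilon> in small idx. norm_at real_line \<epsilon> ((\<lambda>\<epsilon>\<in>idx. F \<epsilon> (u \<epsilon>)) \<epsilon>) \<le> 1 * \<rho> \<epsilon> ^ N" for N
    using negligible_netsD[OF u order_refl, of N] eventually_index
  proof eventually_elim
    case (elim \<epsilon>)
    then show ?case
      using F_le_norm[OF elim(2) sp[OF elim(2)]] by simp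
  qed
qed auto

lemma net_map_class:
  assumes u: "u \<in> moderate \<rho> E idx"
  shows "net_map \<rho> F (gen_class \<rho> E idx u) = gen_class \<rho> real_line idx (\<lambda>\<epsilon>\<in>idx. F \<epsilon> (u \<epsilon>))"
proof -
  have "gen_class \<rho> real_line idx (\<lambda>\<epsilon>\<in>idx. F \<epsilon> (v \<epsilon>)) = gen_class \<rho> real_line idx (\<lambda>\<epsilon>\<in>idx. F \<epsilon> (u \<epsilon>))"
    if v: "v \<in> gen_class \<rho> E idx u" for v
  proof -
    note mv = gen_class_memD(1)[OF order_refl v]
    have vu: "\<forall>\<^sub>F \<epsilon> in small idx. norm_at E \<epsilon> (v \<epsilon> - u \<epsilon>) \<le> \<rho> \<epsilon> ^ K" for K
      using gen_class_eq_iff[OF order_refl mv u] gen_class_memD(2)[OF order_refl v] by simp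
    have "\<forall>\<^sub>F \<epsilon> in small idx. norm_at real_line \<epsilon>
        ((\<lambda>\<epsilon>\<in>idx. F \<epsilon> (v \<epsilon>)) \<epsilon> - (\<lambda>\<epsilon>\<in>idx. F \<epsilon> (u \<epsilon>)) \<epsilon>) \<le> \<rho> \<epsilon> ^ K" for K
      using vu[of K] eventually_index
    proof eventually_elim
      case (elim \<epsilon>)
      then show ?case
        using F_le_norm[OF elim(2) subspace_diff[OF subspace_space_at[OF elim(2)]
              moderate_in_space[OF mv elim(2)] moderate_in_space[OF u elim(2)]]]
        by (simp add: linear_diff[OF linear_F])
    qed
    then show ?thesis
      by (simp only: real.gen_class_eq_iff[OF order_refl F_moderate[OF mv] F_moderate[OF u]] simp_thms)
  qed
  then show ?thesis
    unfolding net_map_def using gen_class_self[OF order_refl u] by (intro SUP_eq_const) blast+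
qed

lemma map_representative_net_map: "map_representative \<rho> E (net_map \<rho> F) F"
  unfolding map_representative_def
  using linear_F F_moderate F_negligible net_map_class by (simp add: linear_add linear_scale)

lemma gen_linear_net_map: "gen_linear \<rho> E (net_map \<rho> F)"
  unfolding gen_linear_def
proof (intro conjI ballI funcsetI)
  fix x assume "x \<in> gen_space \<rho> E idx"
  then obtain u where u: "u \<in> moderate \<rho> E idx" "x = gen_class \<rho> E idx u"
    by (rule gen_space_cases)
  show "net_map \<rho> F x \<in> gen_reals \<rho>"
    using real.gen_class_in_gen_space[OF F_moderate[OF u(1)]] by (simp add: u net_map_class)
  show "net_map \<rho> F (gen_add \<rho> E x y) = gen_add \<rho> real_line (net_map \<rho> F x) (net_map \<rho> F y)"
    if y: "y \<in> gen_space \<rho> E idx" for y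
  proof -
    obtain v where v: "v \<in> moderate \<rho> E idx" "y = gen_class \<rho> E idx v"
      using y by (rule gen_space_cases)
    have "(\<lambda>\<epsilon>\<in>idx. F \<epsilon> ((\<lambda>\<epsilon>\<in>idx. u \<epsilon> + v \<epsilon>) \<epsilon>)) =
        (\<lambda>\<epsilon>\<in>idx. (\<lambda>\<epsilon>\<in>idx. F \<epsilon> (u \<epsilon>)) \<epsilon> + (\<lambda>\<epsilon>\<in>idx. F \<epsilon> (v \<epsilon>)) \<epsilon>)"
      by (rule restrict_ext) (simp add: linear_add[OF linear_F])
    then show ?thesis
      by (simp only: u(2) v(2) gen_add_class[OF u(1) v(1)] net_map_class[OF moderate_add[OF u(1) v(1)]]
          net_map_class[OF u(1)] net_map_class[OF v(1)]
          real.gen_add_class[OF F_moderate[OF u(1)] F_moderate[OF v(1)]])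
  qed
  show "net_map \<rho> F (gen_scale \<rho> E c x) = gen_scale \<rho> real_line c (net_map \<rho> F x)"
    if c: "c \<in> gen_reals \<rho>" for c
  proof -
    obtain a where a: "a \<in> moderate \<rho> real_line idx" "c = gen_class \<rho> real_line idx a"
      using c by (rule real.gen_space_cases)
    have "(\<lambda>\<epsilon>\<in>idx. F \<epsilon> ((\<lambda>\<epsilon>\<in>idx. a \<epsilon> *\<^sub>R u \<epsilon>) \<epsilon>)) = (\<lambda>\<epsilon>\<in>idx. a \<epsilon> *\<^sub>R (\<lambda>\<epsilon>\<in>idx. F \<epsilon> (u \<epsilon>)) \<epsilon>)"
      by (rule restrict_ext) (simp add: linear_scale[OF linear_F])
    then show ?thesis
      by (simp only: u(2) a(2) gen_scale_class[OF a(1) u(1)] net_map_class[OF moderate_scale[OF a(1) u(1)]]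
          net_map_class[OF u(1)] real.gen_scale_class[OF a(1) F_moderate[OF u(1)]])
  qed
qed

lemma continuous_net_map: "continuous_map (sharp_topology \<rho> E) (sharp_topology \<rho> real_line) (net_map \<rho> F)"
  unfolding sharp_topology_def[of \<rho> real_line]
proof (rule continuous_on_generated_topo)
  fix U assume "U \<in> {sharp_ball \<rho> real_line b r |b r. b \<in> gen_reals \<rho> \<and> r \<in> gen_reals \<rho> \<and> gen_pos \<rho> r}"
  then obtain b r where b: "b \<in> gen_reals \<rho>" and r: "r \<in> gen_reals \<rho>" and U: "U = sharp_ball \<rho> real_line b r"
    by blast
  obtain b' where b': "b' \<in> moderate \<rho> real_line idx" "b = gen_class \<rho> real_line idx b'"
    using b by (rule real.gen_space_cases)
  obtain r' where r': "r' \<in> moderate \<rho> real_line idx" "r = gen_class \<rho> real_line idx r'"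
    using r by (rule real.gen_space_cases)
  have U_iff: "net_map \<rho> F (gen_class \<rho> E idx u) \<in> U \<longleftrightarrow>
      (\<exists>n. \<forall>\<^sub>F \<epsilon> in small idx. norm_at real_line \<epsilon> (b' \<epsilon> - (\<lambda>\<epsilon>\<in>idx. F \<epsilon> (u \<epsilon>)) \<epsilon>) + \<rho> \<epsilon> ^ n \<le> r' \<epsilon>)"
    if "u \<in> moderate \<rho> E idx" for u
    unfolding U b'(2) r'(2) net_map_class[OF that]
    by (rule real.sharp_ball_iff[OF b'(1) F_moderate[OF that] r'(1)])
  let ?X = "net_map \<rho> F -` U \<inter> topspace (sharp_topology \<rho> E)"
  show "openin (sharp_topology \<rho> E) ?X"
  proof (subst openin_subopen, intro ballI)
    fix x assume x: "x \<in> ?X"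
    then have "x \<in> gen_space \<rho> E idx" by (simp add: topspace_sharp_topology)
    then obtain u where u: "u \<in> moderate \<rho> E idx" "x = gen_class \<rho> E idx u"
      by (rule gen_space_cases)
    have "net_map \<rho> F (gen_class \<rho> E idx u) \<in> U" using x u(2) by simp
    then obtain n where n: "\<forall>\<^sub>F \<epsilon> in small idx.
        norm_at real_line \<epsilon> (b' \<epsilon> - (\<lambda>\<epsilon>\<in>idx. F \<epsilon> (u \<epsilon>)) \<epsilon>) + \<rho> \<epsilon> ^ n \<le> r' \<epsilon>"
      unfolding U_iff[OF u(1)] by blast
    \<comment> \<open>The margin \<open>\<rho> \<epsilon> ^ n\<close> of the image point inside
      \<open>U\<close> can serve as radius about \<open>x\<close>, because
      \<open>F \<epsilon>\<close> does not increase distances. The margin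
      \<open>\<rho> \<epsilon> ^ m\<close> of a point in the new ball is then also a margin of its
      image in \<open>U\<close>.\<close>
    define s where "s = (\<lambda>\<epsilon>\<in>idx. 1 * \<rho> \<epsilon> ^ n)"
    have s: "s \<in> moderate \<rho> real_line idx"
      unfolding s_def by (rule rho_power_moderate)
    have sn: "\<forall>\<^sub>F \<epsilon> in small idx. \<rho> \<epsilon> ^ n \<le> s \<epsilon>"
      using eventually_index by eventually_elim (simp add: s_def)
    let ?B = "sharp_ball \<rho> E x (gen_class \<rho> real_line idx s)"
    have "?B \<subseteq> ?X"
    proof
      fix y assume y: "y \<in> ?B"
      then have y': "y \<in> gen_space \<rho> E idx" by (simp add: sharp_ball_def)
      then obtain v where v: "v \<in> moderate \<rho> E idx" "y = gen_class \<rho> E idx v"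
        by (rule gen_space_cases)
      obtain m where m: "\<forall>\<^sub>F \<epsilon> in small idx. norm_at E \<epsilon> (u \<epsilon> - v \<epsilon>) + \<rho> \<epsilon> ^ m \<le> s \<epsilon>"
        using y sharp_ball_iff[OF u(1) v(1) s] u(2) v(2) by blast
      have "\<forall>\<^sub>F \<epsilon> in small idx.
          norm_at real_line \<epsilon> (b' \<epsilon> - (\<lambda>\<epsilon>\<in>idx. F \<epsilon> (v \<epsilon>)) \<epsilon>) + \<rho> \<epsilon> ^ m \<le> r' \<epsilon>"
        using n m eventually_index
      proof eventually_elim
        case (elim \<epsilon>)
        have "\<bar>F \<epsilon> (u \<epsilon>) - F \<epsilon> (v \<epsilon>)\<bar> \<le> norm_at E \<epsilon> (u \<epsilon> - v \<epsilon>)"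
          using F_le_norm[OF elim(3) subspace_diff[OF subspace_space_at[OF elim(3)]
              moderate_in_space[OF u(1) elim(3)] moderate_in_space[OF v(1) elim(3)]]]
          by (simp add: linear_diff[OF linear_F[OF elim(3)]])
        then show ?case using elim by (simp add: s_def)
      qed
      then have "net_map \<rho> F y \<in> U"
        unfolding v(2) U_iff[OF v(1)] by blast
      then show "y \<in> ?X"
        using y' by (simp add: topspace_sharp_topology)
    qed
    moreover have "openin (sharp_topology \<rho> E) ?B"
      by (rule openin_sharp_ball[OF \<open>x \<in> gen_space \<rho> E idx\<close> s sn])
    moreover have "x \<in> ?B"
      using centre_in_sharp_ball[OF u(1) s sn] by (simp add: u(2))
    ultimately show "\<exists>T. openin (sharp_topology \<rho> E) T \<and> x \<in> T \<and> T \<subseteq> ?X"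
      by blast
  qed
next
  have "net_map \<rho> F ` topspace (sharp_topology \<rho> E) \<subseteq> topspace (sharp_topology \<rho> real_line)"
    using gen_linear_net_map by (auto simp: gen_linear_def topspace_sharp_topology real.topspace_sharp_topology)
  then show "net_map \<rho> F ` topspace (sharp_topology \<rho> E) \<subseteq>
      \<Union> {sharp_ball \<rho> real_line u r |u r. u \<in> gen_reals \<rho> \<and> r \<in> gen_reals \<rho> \<and> gen_pos \<rho> r}"
    unfolding sharp_topology_def[of \<rho> real_line] topology_generated_by_topspace by blast
qed

lemma closedin_level_set:
  assumes "\<alpha> \<in> gen_reals \<rho>"
  shows "closedin (sharp_topology \<rho> E) (level_set \<rho> E (net_map \<rho> F) \<alpha>)"
  using closedin_continuous_map_preimage[OF continuous_net_map real.closedin_sharp_topology_singleton[OF assms]]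
  by (simp add: level_set_def topspace_sharp_topology)

end

subsection \<open>Strong disjointness as a uniform gap\<close>

context generalized_space
begin

lemma gen_restrict_class:
  assumes L: "L \<subseteq> idx" and u: "u \<in> moderate \<rho> E idx"
  shows "restrict u L \<in> moderate \<rho> E L"
    and "gen_restrict \<rho> E L (gen_class \<rho> E idx u) = gen_class \<rho> E L (restrict u L)"
proof -
  have mod: "restrict v L \<in> moderate \<rho> E L" if v: "v \<in> moderate \<rho> E idx" for v
  proof -
    obtain N where N: "\<forall>\<^sub>F \<epsilon> in small idx. norm_at E \<epsilon> (v \<epsilon>) \<le> inverse (\<rho> \<epsilon>) ^ N"
      by (rule moderateE[OF v order_refl])
    show ?thesis
    proof (rule moderateI[OF L, where c = 1 and N = N])
      show "\<forall>\<^sub>F \<epsilon> in small L. norm_at E \<epsilon> (restrict v L \<epsilon>) \<le> 1 * inverse (\<rho> \<epsilon>) ^ N"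
        using eventually_small_mono[OF N L] eventually_index by eventually_elim simp
    qed (use moderate_in_space[OF v] L in auto)
  qed
  show "restrict u L \<in> moderate \<rho> E L" by (rule mod[OF u])
  have "gen_class \<rho> E L (restrict v L) = gen_class \<rho> E L (restrict u L)"
    if v: "v \<in> gen_class \<rho> E idx u" for v
  proof -
    note mv = gen_class_memD(1)[OF order_refl v]
    have "\<forall>\<^sub>F \<epsilon> in small idx. norm_at E \<epsilon> (v \<epsilon> - u \<epsilon>) \<le> \<rho> \<epsilon> ^ K" for K
      using gen_class_eq_iff[OF order_refl mv u] gen_class_memD(2)[OF order_refl v] by simp
    then have ev: "\<forall>\<^sub>F \<epsilon> in small L. norm_at E \<epsilon> (v \<epsilon> - u \<epsilon>) \<le> \<rho> \<epsilon> ^ K" for K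
      using L by (rule eventually_small_mono)
    have "\<forall>\<^sub>F \<epsilon> in small L. norm_at E \<epsilon> (restrict v L \<epsilon> - restrict u L \<epsilon>) \<le> \<rho> \<epsilon> ^ K" for K
      using ev[of K] eventually_index by eventually_elim simp
    then show ?thesis
      by (simp only: gen_class_eq_iff[OF L mod[OF mv] mod[OF u]] simp_thms)
  qed
  then show "gen_restrict \<rho> E L (gen_class \<rho> E idx u) = gen_class \<rho> E L (restrict u L)"
    unfolding gen_restrict_def using gen_class_self[OF order_refl u] by (intro SUP_eq_const) blast+
qed

section \<open>Elements of internal sets\<close>

lemma internal_setE:
  assumes "x \<in> internal_set \<rho> E S"
  obtains u where "u \<in> moderate \<rho> E idx" "x = gen_class \<rho> E idx u" "\<forall>\<^sub>F \<epsilon> in small idx. u \<epsilon> \<in> S \<epsilon>"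
  using assms gen_space_memD unfolding internal_set_def by blast

lemma internal_setI:
  assumes "u \<in> moderate \<rho> E idx" "\<forall>\<^sub>F \<epsilon> in small idx. u \<epsilon> \<in> S \<epsilon>"
  shows "gen_class \<rho> E idx u \<in> internal_set \<rho> E S"
  using gen_class_in_gen_space[OF assms(1)] gen_class_self[OF order_refl assms(1)] assms(2)
  unfolding internal_set_def by blast

text \<open>Turns an arbitrary selection on \<open>L\<close> into an element of the internal set.
  Sharp boundedness makes the glued net moderate however the selection was made; an existing element
  supplies the values off \<open>L\<close>.\<close>

lemma internal_set_prescribed:
  assumes "internal_set \<rho> E S \<noteq> {}" and S: "\<And>\<epsilon>. \<epsilon> \<in> idx \<Longrightarrow> S \<epsilon> \<subseteq> space_at E \<epsilon>"
    and "sharply_bounded \<rho> E S" and L: "L \<subseteq> idx" and a: "\<And>\<epsilon>. \<epsilon> \<in> L \<Longrightarrow> a \<epsilon> \<in> S \<epsilon>"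
  obtains u where "u \<in> moderate \<rho> E idx" "gen_class \<rho> E idx u \<in> internal_set \<rho> E S"
    "\<And>\<epsilon>. \<epsilon> \<in> L \<Longrightarrow> u \<epsilon> = a \<epsilon>"
proof -
  obtain x where "x \<in> internal_set \<rho> E S" using assms(1) by blast
  then obtain v where v: "v \<in> moderate \<rho> E idx" "\<forall>\<^sub>F \<epsilon> in small idx. v \<epsilon> \<in> S \<epsilon>"
    by (rule internal_setE)
  obtain N where N: "\<forall>\<^sub>F \<epsilon> in small idx. \<forall>u\<in>S \<epsilon>. norm_at E \<epsilon> u \<le> inverse (\<rho> \<epsilon>) ^ N"
    using assms(3) unfolding sharply_bounded_def by blast
  define u where "u = (\<lambda>\<epsilon>\<in>idx. if \<epsilon> \<in> L then a \<epsilon> else v \<epsilon>)"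
  have uS: "\<forall>\<^sub>F \<epsilon> in small idx. u \<epsilon> \<in> S \<epsilon>"
    using v(2) eventually_index by eventually_elim (simp add: u_def a)
  have u: "u \<in> moderate \<rho> E idx"
  proof (rule moderateI[OF order_refl, where c = 1 and N = N])
    show "u \<in> Pi\<^sub>E idx (space_at E)"
      using moderate_in_space[OF v(1)] S a unfolding u_def by fastforce
    show "\<forall>\<^sub>F \<epsilon> in small idx. norm_at E \<epsilon> (u \<epsilon>) \<le> 1 * inverse (\<rho> \<epsilon>) ^ N"
      using uS N by eventually_elim simp
  qed
  show ?thesis
  proof (rule that[OF u internal_setI[OF u uS]])
    show "u \<epsilon> = a \<epsilon>" if "\<epsilon> \<in> L" for \<epsilon>
      using that L by (auto simp: u_def)
  qed
qed

lemma strongly_disjoint_gap: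
  assumes disj: "strongly_disjoint \<rho> E (internal_set \<rho> E S) (internal_set \<rho> E T)"
    and S: "internal_set \<rho> E S \<noteq> {}" "\<And>\<epsilon>. \<epsilon> \<in> idx \<Longrightarrow> S \<epsilon> \<subseteq> space_at E \<epsilon>" "sharply_bounded \<rho> E S"
    and T: "internal_set \<rho> E T \<noteq> {}" "\<And>\<epsilon>. \<epsilon> \<in> idx \<Longrightarrow> T \<epsilon> \<subseteq> space_at E \<epsilon>" "sharply_bounded \<rho> E T"
  shows "\<exists>N. \<forall>\<^sub>F \<epsilon> in small idx. \<forall>a\<in>S \<epsilon>. \<forall>c\<in>T \<epsilon>. \<rho> \<epsilon> ^ N \<le> norm_at E \<epsilon> (c - a)"
proof (rule ccontr)
  assume "\<not> ?thesis"
  then have no_gap: "\<not> (\<forall>\<^sub>F \<epsilon> in small idx. \<forall>a\<in>S \<epsilon>. \<forall>c\<in>T \<epsilon>. \<rho> \<epsilon> ^ N \<le> norm_at E \<epsilon> (c - a))" for N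
    by blast
  have "\<exists>\<epsilon>\<in>idx. \<epsilon> < d \<and> (\<exists>a\<in>S \<epsilon>. \<exists>c\<in>T \<epsilon>. norm_at E \<epsilon> (c - a) < \<rho> \<epsilon> ^ N)" if "0 < d" for N d
  proof (rule ccontr)
    assume neg: "\<not> ?thesis"
    have "\<forall>\<^sub>F \<epsilon> in small idx. \<epsilon> < d"
      using that by (intro order_tendstoD[OF tendsto_ident_at])
    then have "\<forall>\<^sub>F \<epsilon> in small idx. \<forall>a\<in>S \<epsilon>. \<forall>c\<in>T \<epsilon>. \<rho> \<epsilon> ^ N \<le> norm_at E \<epsilon> (c - a)"
      using eventually_index
    proof eventually_elim
      case (elim \<epsilon>)
      with neg show ?case by (meson not_le)
    qed
    with no_gap show False by blast
  qed
  \<comment> \<open>A single parameter \<open>N\<close> drives both the index towards 0 and the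
    distance below ever higher powers of the gauge; this is the diagonal choice.\<close>
  then have "\<forall>N. \<exists>\<epsilon>. \<epsilon> \<in> idx \<and> \<epsilon> < inverse (real (Suc N)) \<and>
      (\<exists>a\<in>S \<epsilon>. \<exists>c\<in>T \<epsilon>. norm_at E \<epsilon> (c - a) < \<rho> \<epsilon> ^ N)"
    by (meson inverse_positive_iff_positive of_nat_0_less_iff zero_less_Suc)
  then obtain e where e: "\<And>N. e N \<in> idx" "\<And>N. e N < inverse (real (Suc N))"
    and close: "\<And>N. \<exists>a\<in>S (e N). \<exists>c\<in>T (e N). norm_at E (e N) (c - a) < \<rho> (e N) ^ N"
    by (auto dest!: choice)
  define L where "L = range e"
  \<comment> \<open>The sequence \<open>e\<close> may repeat values, whereas a net has one value per
    index. Choosing one preimage \<open>k \<epsilon>\<close> of each \<epsilon> selects one pair of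
    points, with a definite exponent.\<close>
  define k where "k = inv e"
  have ek: "e (k \<epsilon>) = \<epsilon>" if "\<epsilon> \<in> L" for \<epsilon>
    using that unfolding L_def k_def by (rule f_inv_into_f)
  have L: "L \<subseteq> idx" using e by (auto simp: L_def)
  have "e \<longlonglongrightarrow> 0"
  proof (rule tendsto_sandwich[OF _ _ tendsto_const LIMSEQ_inverse_real_of_nat])
    show "\<forall>\<^sub>F n in sequentially. 0 \<le> e n"
      using e(1) by (auto simp: idx_def intro!: always_eventually less_imp_le)
    show "\<forall>\<^sub>F n in sequentially. e n \<le> inverse (real (Suc n))"
      using e(2) by (auto intro!: always_eventually less_imp_le)
  qed
  then have closure: "0 \<in> closure L"
    unfolding closure_sequential L_def by blast
  have "\<forall>\<epsilon>. \<exists>a c. \<epsilon> \<in> L \<longrightarrow> a \<in> S \<epsilon> \<and> c \<in> T \<epsilon> \<and> norm_at E \<epsilon> (c - a) < \<rho> \<epsilon> ^ k \<epsilon>"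
    using close ek by metis
  then obtain a c where a: "\<And>\<epsilon>. \<epsilon> \<in> L \<Longrightarrow> a \<epsilon> \<in> S \<epsilon>" and c: "\<And>\<epsilon>. \<epsilon> \<in> L \<Longrightarrow> c \<epsilon> \<in> T \<epsilon>"
    and ca: "\<And>\<epsilon>. \<epsilon> \<in> L \<Longrightarrow> norm_at E \<epsilon> (c \<epsilon> - a \<epsilon>) < \<rho> \<epsilon> ^ k \<epsilon>"
    by metis
  obtain u where u: "u \<in> moderate \<rho> E idx" "gen_class \<rho> E idx u \<in> internal_set \<rho> E S"
    "\<And>\<epsilon>. \<epsilon> \<in> L \<Longrightarrow> u \<epsilon> = a \<epsilon>"
    using internal_set_prescribed[where a = a, OF S L a] by blast
  obtain v where v: "v \<in> moderate \<rho> E idx" "gen_class \<rho> E idx v \<in> internal_set \<rho> E T"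
    "\<And>\<epsilon>. \<epsilon> \<in> L \<Longrightarrow> v \<epsilon> = c \<epsilon>"
    using internal_set_prescribed[where a = c, OF T L c] by blast
  \<comment> \<open>If \<open>k \<epsilon> < M\<close>, then \<epsilon> is one of the finitely many
    values \<open>e 0\<close>, ..., \<open>e (M - 1)\<close>, and these are avoided close to 0. No
    monotonicity of \<open>e\<close> is involved.\<close>
  have k_large: "\<forall>\<^sub>F \<epsilon> in small L. M \<le> k \<epsilon>" for M
  proof -
    have "\<forall>\<^sub>F \<epsilon> in small L. \<forall>j\<in>{..<M}. \<epsilon> \<noteq> e j"
      by (intro eventually_ball_finite) (auto intro: eventually_neq_at_within)
    then show ?thesis
      using eventually_index
    proof eventually_elim
      case (elim \<epsilon>)
      then show ?case using ek[OF elim(2)] by (metis lessThan_iff not_le)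
    qed
  qed
  have "\<forall>\<^sub>F \<epsilon> in small L. norm_at E \<epsilon> (restrict v L \<epsilon> - restrict u L \<epsilon>) \<le> \<rho> \<epsilon> ^ M" for M
    using k_large[of M] eventually_index
  proof eventually_elim
    case (elim \<epsilon>)
    then have \<epsilon>: "\<epsilon> \<in> idx" using L by blast
    have "\<rho> \<epsilon> ^ k \<epsilon> \<le> \<rho> \<epsilon> ^ M"
      using elim(1) rho_pos[OF \<epsilon>] rho_le_1[OF \<epsilon>] by (intro power_decreasing) auto
    then show ?case using ca[OF elim(2)] u(3)[OF elim(2)] v(3)[OF elim(2)] elim(2) by simp
  qed
  then have "gen_class \<rho> E L (restrict v L) = gen_class \<rho> E L (restrict u L)"
    by (simp only: gen_class_eq_iff[OF L gen_restrict_class(1)[OF L v(1)] gen_restrict_class(1)[OF L u(1)]]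
        simp_thms)
  then have "gen_restrict \<rho> E L (gen_class \<rho> E idx u) = gen_restrict \<rho> E L (gen_class \<rho> E idx v)"
    by (simp only: gen_restrict_class(2)[OF L] u(1) v(1))
  then have "gen_restrict \<rho> E L ` internal_set \<rho> E S \<inter> gen_restrict \<rho> E L ` internal_set \<rho> E T \<noteq> {}"
    using u(2) v(2) by blast
  with disj L closure show False
    unfolding strongly_disjoint_def by blast
qed

end

subsection \<open>Strict separation\<close>

theorem theorem36:
  fixes \<rho> :: "real \<Rightarrow> real"
    and E :: "'a::real_vector normed_family"
    and A C :: "(real \<Rightarrow> 'a) set set"
  assumes "gauge_net \<rho>" and "normed_spaces E"
    and "internal \<rho> E A" and "A \<noteq> {}"
    and "internal \<rho> E C" and "C \<noteq> {}"
    and "functionally_compact \<rho> E A"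
    and "strongly_disjoint \<rho> E A C"
    and "has_bounded_convex_representative \<rho> E A"
    and "has_bounded_convex_representative \<rho> E C"
  shows "\<exists>f F \<alpha> r.
      gen_linear \<rho> E f \<and> map_representative \<rho> E f F \<and>
      continuous_map (sharp_topology \<rho> E) (sharp_topology \<rho> real_line) f \<and>
      non_identically_null \<rho> E f \<and>
      \<alpha> \<in> gen_reals \<rho> \<and> r \<in> gen_reals \<rho> \<and> gen_pos \<rho> r \<and>
      closedin (sharp_topology \<rho> E) (level_set \<rho> E f \<alpha>) \<and>
      (\<forall>x\<in>A. \<forall>y\<in>C.
         gen_le (gen_add \<rho> real_line (f x) r) \<alpha> \<and>
         gen_le \<alpha> (gen_diff \<rho> real_line (f y) r))"
proof -
  interpret generalized_space \<rho> E
    by unfold_locales (fact assms)+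
  interpret real: generalized_space \<rho> real_line
    by (rule generalized_space_real_line)
  obtain S where S: "\<And>\<epsilon>. \<epsilon> \<in> idx \<Longrightarrow> S \<epsilon> \<subseteq> space_at E \<epsilon>" "A = internal_set \<rho> E S"
    "sharply_bounded \<rho> E S" "\<And>\<epsilon>. \<epsilon> \<in> idx \<Longrightarrow> convex (S \<epsilon>)"
    using assms(9) unfolding has_bounded_convex_representative_def set_representative_def by blast
  obtain T where T: "\<And>\<epsilon>. \<epsilon> \<in> idx \<Longrightarrow> T \<epsilon> \<subseteq> space_at E \<epsilon>" "C = internal_set \<rho> E T"
    "sharply_bounded \<rho> E T" "\<And>\<epsilon>. \<epsilon> \<in> idx \<Longrightarrow> convex (T \<epsilon>)"
    using assms(10) unfolding has_bounded_convex_representative_def set_representative_def by blast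
  obtain N where N: "\<forall>\<^sub>F \<epsilon> in small idx. \<forall>a\<in>S \<epsilon>. \<forall>c\<in>T \<epsilon>. \<rho> \<epsilon> ^ N \<le> norm_at E \<epsilon> (c - a)"
    using strongly_disjoint_gap[of S T] assms(4,6,8) S T by blast
  obtain a where a: "a \<in> moderate \<rho> E idx" "\<forall>\<^sub>F \<epsilon> in small idx. a \<epsilon> \<in> S \<epsilon>"
    using assms(4) unfolding S(2) by (metis ex_in_conv internal_setE)
  obtain c where c: "c \<in> moderate \<rho> E idx" "\<forall>\<^sub>F \<epsilon> in small idx. c \<epsilon> \<in> T \<epsilon>"
    using assms(6) unfolding T(2) by (metis ex_in_conv internal_setE)

  \<comment> \<open>A linear functional with the norm bound must exist at every index, while
    separation is possible only where both sets are nonempty and the gap is present. The zero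
    functional is the default at the other indices, of which none are small.\<close>
  define good where "good \<epsilon> \<longleftrightarrow> S \<epsilon> \<noteq> {} \<and> T \<epsilon> \<noteq> {} \<and>
    (\<forall>a\<in>S \<epsilon>. \<forall>c\<in>T \<epsilon>. \<rho> \<epsilon> ^ N \<le> norm_at E \<epsilon> (c - a))" for \<epsilon>
  have "\<exists>f. linear f \<and> (\<forall>x\<in>space_at E \<epsilon>. \<bar>f x\<bar> \<le> norm_at E \<epsilon> x) \<and>
      (good \<epsilon> \<longrightarrow> (\<forall>a\<in>S \<epsilon>. \<forall>c\<in>T \<epsilon>. f a + \<rho> \<epsilon> ^ N \<le> f c))" if \<epsilon>: "\<epsilon> \<in> idx" for \<epsilon>
  proof (cases "good \<epsilon>")
    case True
    show ?thesis
      using norm_on_separation[OF subspace_space_at[OF \<epsilon>] norm_on_norm_at[OF \<epsilon>],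
          of "S \<epsilon>" "T \<epsilon>" "\<rho> \<epsilon> ^ N"] True S(1,4)[OF \<epsilon>] T(1,4)[OF \<epsilon>]
      unfolding good_def by metis
  next
    case False
    then show ?thesis
      using norm_at_nonneg[OF \<epsilon>] by (intro exI[of _ "\<lambda>_. 0"]) (simp add: linear_zero)
  qed
  then obtain F where F: "\<And>\<epsilon>. \<epsilon> \<in> idx \<Longrightarrow> linear (F \<epsilon>)"
    "\<And>\<epsilon> x. \<epsilon> \<in> idx \<Longrightarrow> x \<in> space_at E \<epsilon> \<Longrightarrow> \<bar>F \<epsilon> x\<bar> \<le> norm_at E \<epsilon> x"
    "\<And>\<epsilon> a c. \<epsilon> \<in> idx \<Longrightarrow> good \<epsilon> \<Longrightarrow> a \<in> S \<epsilon> \<Longrightarrow> c \<in> T \<epsilon> \<Longrightarrow> F \<epsilon> a + \<rho> \<epsilon> ^ N \<le> F \<epsilon> c"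
    by metis
  interpret functional_net \<rho> E F
    by (intro functional_net.intro functional_net_axioms.intro generalized_space_axioms F)

  have good: "\<forall>\<^sub>F \<epsilon> in small idx. \<epsilon> \<in> idx \<and> good \<epsilon>"
    using N a(2) c(2) eventually_index by eventually_elim (auto simp: good_def)
  \<comment> \<open>On \<open>T \<epsilon>\<close> the functional exceeds its supremum over
    \<open>S \<epsilon>\<close> by at least \<open>\<rho> \<epsilon> ^ N\<close>. Raising that
    supremum by half the gap leaves the other half free on the side of \<open>T \<epsilon>\<close>,
    which explains \<open>r\<close>.\<close>
  define \<alpha> where "\<alpha> = (\<lambda>\<epsilon>\<in>idx. Sup (F \<epsilon> ` S \<epsilon>) + 1 / 2 * \<rho> \<epsilon> ^ N)"
  define r where "r = (\<lambda>\<epsilon>\<in>idx. 1 / 2 * \<rho> \<epsilon> ^ N)"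
  have separated: "F \<epsilon> x + r \<epsilon> \<le> \<alpha> \<epsilon>" "\<alpha> \<epsilon> \<le> F \<epsilon> y - r \<epsilon>"
    if \<epsilon>: "\<epsilon> \<in> idx \<and> good \<epsilon>" and x: "x \<in> S \<epsilon>" and y: "y \<in> T \<epsilon>" for \<epsilon> x y
  proof -
    have le: "F \<epsilon> s \<le> F \<epsilon> y - \<rho> \<epsilon> ^ N" if "s \<in> S \<epsilon>" for s
      using F(3)[of \<epsilon> s y] \<epsilon> that y by simp
    have "F \<epsilon> x \<le> Sup (F \<epsilon> ` S \<epsilon>)"
      using x le by (intro cSup_upper) (auto intro!: bdd_aboveI2)
    moreover have "Sup (F \<epsilon> ` S \<epsilon>) \<le> F \<epsilon> y - \<rho> \<epsilon> ^ N"
      using x le by (intro cSup_least) auto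
    ultimately show "F \<epsilon> x + r \<epsilon> \<le> \<alpha> \<epsilon>" "\<alpha> \<epsilon> \<le> F \<epsilon> y - r \<epsilon>"
      using \<epsilon> by (simp_all add: \<alpha>_def r_def)
  qed
  have r: "r \<in> moderate \<rho> real_line idx"
    unfolding r_def by (rule rho_power_moderate)
  have r_pos: "gen_pos \<rho> (gen_class \<rho> real_line idx r)"
    unfolding gen_pos_iff[OF r]
  proof
    \<comment> \<open>The factor 1/2 in \<open>r\<close> costs one further power.\<close>
    show "\<forall>\<^sub>F \<epsilon> in small idx. \<rho> \<epsilon> ^ Suc N \<le> r \<epsilon>"
      using eventually_rho_power[OF order_refl, of 2 N] eventually_index
      by eventually_elim (simp add: r_def)
  qed
  obtain M where M: "\<forall>\<^sub>F \<epsilon> in small idx. \<forall>u\<in>S \<epsilon>. norm_at E \<epsilon> u \<le> inverse (\<rho> \<epsilon>) ^ M"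
    using S(3) unfolding sharply_bounded_def by blast
  have \<alpha>: "\<alpha> \<in> moderate \<rho> real_line idx"
  \<comment> \<open>The constant 2 counts the supremum, bounded by the sharp bound because the
    functionals have norm at most one, and the half gap, which is at most 1 and hence below the same
    power.\<close>
  proof (rule real.moderateI[OF order_refl, where c = 2 and N = M])
    show "\<forall>\<^sub>F \<epsilon> in small idx. norm_at real_line \<epsilon> (\<alpha> \<epsilon>) \<le> 2 * inverse (\<rho> \<epsilon>) ^ M"
      using M a(2) eventually_index
    proof eventually_elim
      case (elim \<epsilon>)
      have "\<bar>Sup (F \<epsilon> ` S \<epsilon>)\<bar> \<le> inverse (\<rho> \<epsilon>) ^ M"
      proof (rule cSup_abs_le)
        show "\<bar>z\<bar> \<le> inverse (\<rho> \<epsilon>) ^ M" if "z \<in> F \<epsilon> ` S \<epsilon>" for z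
          using that elim(1) F(2)[OF elim(3)] S(1)[OF elim(3)] by force
      qed (use elim(2) in auto)
      moreover have "0 \<le> 1 / 2 * \<rho> \<epsilon> ^ N" "1 / 2 * \<rho> \<epsilon> ^ N \<le> 1"
        using rho_pos[OF elim(3)] power_le_one[OF _ rho_le_1[OF elim(3)], of N] by auto
      moreover have "1 \<le> inverse (\<rho> \<epsilon>) ^ M"
        by (rule one_le_power[OF inverse_rho_ge_1[OF elim(3)]])
      ultimately show ?case
        using elim(3) by (simp add: \<alpha>_def)
    qed
  qed (simp add: \<alpha>_def)

  have "non_identically_null \<rho> E (net_map \<rho> F)"
  proof -
    \<comment> \<open>The witness joins a point of \<open>S \<epsilon>\<close> to a point of
      \<open>T \<epsilon>\<close>, so the functional is at least the full gap on it.\<close>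
    define w where "w = (\<lambda>\<epsilon>\<in>idx. c \<epsilon> - a \<epsilon>)"
    have w: "w \<in> moderate \<rho> E idx"
      unfolding w_def by (rule moderate_diff[OF c(1) a(1)])
    note norm = real.gen_norm_class[OF F_moderate[OF w]]
    have "\<forall>\<^sub>F \<epsilon> in small idx. \<rho> \<epsilon> ^ N \<le> (\<lambda>\<epsilon>\<in>idx. norm_at real_line \<epsilon> ((\<lambda>\<epsilon>\<in>idx. F \<epsilon> (w \<epsilon>)) \<epsilon>)) \<epsilon>"
      using good a(2) c(2)
    proof eventually_elim
      case (elim \<epsilon>)
      then have "\<rho> \<epsilon> ^ N \<le> F \<epsilon> (c \<epsilon>) - F \<epsilon> (a \<epsilon>)"
        using F(3)[of \<epsilon> "a \<epsilon>" "c \<epsilon>"] by simp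
      then show ?case
        using elim(1) by (simp add: w_def linear_diff[OF F(1)])
    qed
    then have "gen_pos \<rho> (gen_norm \<rho> real_line (net_map \<rho> F (gen_class \<rho> E idx w)))"
      unfolding net_map_class[OF w] norm(2) gen_pos_iff[OF norm(1)] by blast
    then show ?thesis
      unfolding non_identically_null_def using gen_class_in_gen_space[OF w] by blast
  qed
  moreover have "gen_le (gen_add \<rho> real_line (net_map \<rho> F x) (gen_class \<rho> real_line idx r)) (gen_class \<rho> real_line idx \<alpha>)"
    if "x \<in> A" for x
  proof -
    obtain u where u: "u \<in> moderate \<rho> E idx" "x = gen_class \<rho> E idx u" "\<forall>\<^sub>F \<epsilon> in small idx. u \<epsilon> \<in> S \<epsilon>"
      using \<open>x \<in> A\<close> unfolding S(2) by (rule internal_setE)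
    show ?thesis
      unfolding u(2) net_map_class[OF u(1)] real.gen_add_class[OF F_moderate[OF u(1)] r]
    proof (rule gen_le_classI[OF real.moderate_add[OF F_moderate[OF u(1)] r] \<alpha>])
      show "\<forall>\<^sub>F \<epsilon> in small idx. (\<lambda>\<epsilon>\<in>idx. (\<lambda>\<epsilon>\<in>idx. F \<epsilon> (u \<epsilon>)) \<epsilon> + r \<epsilon>) \<epsilon> \<le> \<alpha> \<epsilon>"
        \<comment> \<open>\<open>separated\<close> compares a point of each set: the fixed net
          \<open>c\<close> supplies the point of \<open>T \<epsilon>\<close> here, as the net
          \<open>a\<close> supplies that of \<open>S \<epsilon>\<close> in the estimate for
          \<open>C\<close>.\<close>
        using good u(3) c(2)
      proof eventually_elim
        case (elim \<epsilon>)
        then show ?case using separated(1)[OF elim] by simp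
      qed
    qed
  qed
  moreover have "gen_le (gen_class \<rho> real_line idx \<alpha>) (gen_diff \<rho> real_line (net_map \<rho> F y) (gen_class \<rho> real_line idx r))"
    if "y \<in> C" for y
  proof -
    obtain v where v: "v \<in> moderate \<rho> E idx" "y = gen_class \<rho> E idx v" "\<forall>\<^sub>F \<epsilon> in small idx. v \<epsilon> \<in> T \<epsilon>"
      using \<open>y \<in> C\<close> unfolding T(2) by (rule internal_setE)
    show ?thesis
      unfolding v(2) net_map_class[OF v(1)] real.gen_diff_class[OF F_moderate[OF v(1)] r]
    proof (rule gen_le_classI[OF \<alpha> real.moderate_diff[OF F_moderate[OF v(1)] r]])
      show "\<forall>\<^sub>F \<epsilon> in small idx. \<alpha> \<epsilon> \<le> (\<lambda>\<epsilon>\<in>idx. (\<lambda>\<epsilon>\<in>idx. F \<epsilon> (v \<epsilon>)) \<epsilon> - r \<epsilon>) \<epsilon>"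
        using good a(2) v(3)
      proof eventually_elim
        case (elim \<epsilon>)
        then show ?case using separated(2)[OF elim] by simp
      qed
    qed
  qed
  moreover note gen_linear_net_map map_representative_net_map continuous_net_map r_pos
    real.gen_class_in_gen_space[OF \<alpha>] real.gen_class_in_gen_space[OF r]
    closedin_level_set[OF real.gen_class_in_gen_space[OF \<alpha>]]
  ultimately show ?thesis by blast
qed

end
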